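(* Let $\mathcal{T}_\sigma$ be a pinwheel-like substitution tiling, where $\sigma$ is a primitive self-similar substitution in $\mathbb{R}^2$ with prototiles $T_1,\dots,T_m$. Then $\mathcal{T}_\sigma$ is of statistical circular symmetry. Consequently, the tiling space $\mathbb{X}_\sigma$ is of statistical circular symmetry, too, i.e. each element of $\mathbb{X}_\sigma$ is of statistical circular symmetry.
   Context: Identify $\mathbb{R}^2$ with $\mathbb{C}$. $R_\alpha$ is the rotation through the angle $\alpha$ about the origin, and a bar denotes reflection in the horizontal axis. A tiling of $\mathbb{R}^2$ is a covering of $\mathbb{R}^2$ by compact sets (tiles) with nonempty interior which is also a packing (distinct tiles have disjoint interiors). Prototiles, copies, orientation. Fix finitely many prototiles $T_1,\dots,T_m\subset\mathbb{R}^2$. A copy of $T_i$ is a tile of the form $R_\alpha T_i+t$ or, if reflections are allowed, $R_\alpha\overline{T_i}+t$, with $\alpha\in[0,2\pi)$, $t\in\mathbb{R}^2$. Such a tile $T$ is assigned the angle $\alpha(T)=\alpha$. Two tiles are of the same type if they are congruent to the same prototile. If prototiles have nontrivial symmetries, or two prototiles are congruent, tiles carry markings or labels, so that type and angle of each tile are well defined; congruences respect these markings. Substitution. A self-similar substitution $\sigma$ with substitution factor $\lambda>1$ assigns to each prototile $T_i$ a finite set $\sigma(T_i)$ of copies of prototiles with pairwise disjoint interiors such that $\lambda T_i=\bigcup_{T\in\sigma(T_i)}T$. It is extended to copies by $\sigma(R_\alpha T_i+t)=R_\alpha\sigma(T_i)+\lambda t$ and $\sigma(R_\alpha\overline{T_i}+t)=R_\alpha\overline{\sigma(T_i)}+\lambda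 t$, and to sets of copies by taking unions; so $\sigma^n(T_i)$ is defined for all $n\ge 1$. The substitution matrix is the $m\times m$ matrix whose $(i,j)$ entry counts the tiles of type $T_j$ in $\sigma(T_i)$; $\sigma$ is primitive if some power of this matrix has only positive entries. Substitution tilings. A patch of a tiling is a finite subset of it. A tiling $\mathcal{T}$ by copies of the prototiles is a substitution tiling (with respect to $\sigma$) if each patch in $\mathcal{T}$ is congruent to some patch in $\sigma^n(T_i)$ for appropriate $n,i$. The tiling space $\mathbb{X}_\sigma$ is the set of all substitution tilings with respect to $\sigma$. Pinwheel-like. A substitution tiling $\mathcal{T}$ is pinwheel-like if there are infinitely many different values $\alpha(T)$ for $T\in\mathcal{T}$. Statistical circular symmetry. Let $\mathcal{T}=\{S_1,S_2,\dots\}$ be a substitution tiling with respect to a primitive substitution $\sigma$, whose tiles are arranged in a sequence $(S_j)_{j\ge1}$ satisfying the following: for all $n\ge1$ there is some $\ell\ge n$ such that the patch $\{S_1,\dots,S_\ell\}$ is congruent to $\sigma^k(T_i)$ for some $k,i$. The tiling $\mathcal{T}$ has (is of) statistical circular symmetry if, for all $0\le x<y<2\pi$, $$\lim_{n\to\infty}\frac1n\sum_{j=1}^n 1_{[x,y]}(\alpha(S_j))=\frac{y-x}{2\pi}.$$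
   Formalization: Proved for tilings whose tiles admit a sequence with supertile initial segments (otherwise the notion is undefined), and with the limits holding for some such sequence; for every such sequence the claim is false, e.g. when tiles between sparse supertile segments are listed by increasing angle. *)

theory Defs
  imports "HOL-Analysis.Analysis" "HOL-Library.Real_Mod"
begin

text \<open>
  A motion \<open>Motion s \<alpha> t\<close> encodes the isometry \<open>z \<mapsto> R\<^sub>\<alpha> z + t\<close> of the plane
  (if \<open>s\<close> is false) or \<open>z \<mapsto> R\<^sub>\<alpha> (cnj z) + t\<close> (if \<open>s\<close> is true).  The encoding is unique if
  \<open>\<alpha>\<close> lies in \<open>[0, 2\<pi>)\<close>, which is what \<open>normalized\<close> says.
\<close>

datatype motion = Motion (mirrored: bool) (rot_angle: real) (translation: complex)

definition act :: "motion \<Rightarrow> complex \<Rightarrow> complex" where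
  "act g z = cis (rot_angle g) * (if mirrored g then cnj z else z) + translation g"

definition normalized :: "motion \<Rightarrow> bool" where
  "normalized g \<longleftrightarrow> rot_angle g \<in> {0..<2 * pi}"

definition id_motion :: motion where
  "id_motion = Motion False 0 0"

definition comp_motion :: "motion \<Rightarrow> motion \<Rightarrow> motion" where
  "comp_motion g h =
     Motion (mirrored g \<noteq> mirrored h)
            ((rot_angle g + (if mirrored g then - rot_angle h else rot_angle h)) rmod (2 * pi))
            (act g (translation h))"

definition scale_motion :: "real \<Rightarrow> motion \<Rightarrow> motion" where
  "scale_motion lam g = Motion (mirrored g) (rot_angle g) (of_real lam * translation g)"

text \<open>
  A tile is a marked copy of a prototile: the prototile's index together with the motion carrying
  the prototile to the tile.  Thus type and angle are well defined even if prototiles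
  have symmetries or are congruent to each other.  The point set of a tile is its \<open>support\<close>.
\<close>

type_synonym 'i tile = "'i \<times> motion"

definition tile_type :: "'i tile \<Rightarrow> 'i" where
  "tile_type t = fst t"

definition tile_angle :: "'i tile \<Rightarrow> real" where
  "tile_angle t = rot_angle (snd t)"

definition support :: "('i \<Rightarrow> complex set) \<Rightarrow> 'i tile \<Rightarrow> complex set" where
  "support T t = act (snd t) ` T (fst t)"

text \<open>The flag \<open>mir\<close> records whether reflected copies of the prototiles are allowed.\<close>

definition copies :: "bool \<Rightarrow> 'i tile set" where
  "copies mir = {t. normalized (snd t) \<and> (mirrored (snd t) \<longrightarrow> mir)}"

definition packing :: "('i \<Rightarrow> complex set) \<Rightarrow> 'i tile set \<Rightarrow> bool" where
  "packing T X \<longleftrightarrow>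
     (\<forall>s\<in>X. \<forall>t\<in>X. s \<noteq> t \<longrightarrow> interior (support T s) \<inter> interior (support T t) = {})"

definition tiling :: "bool \<Rightarrow> ('i \<Rightarrow> complex set) \<Rightarrow> 'i tile set \<Rightarrow> bool" where
  "tiling mir T X \<longleftrightarrow>
     X \<subseteq> copies mir \<and> (\<Union>t\<in>X. support T t) = UNIV \<and> packing T X"

definition move :: "motion \<Rightarrow> 'i tile \<Rightarrow> 'i tile" where
  "move g t = (fst t, comp_motion g (snd t))"

text \<open>Congruence of sets of tiles, respecting markings; orientation may be reversed.\<close>

definition congruent_tiles :: "'i tile set \<Rightarrow> 'i tile set \<Rightarrow> bool" where
  "congruent_tiles P Q \<longleftrightarrow> (\<exists>g. normalized g \<and> Q = move g ` P)"

definition self_similar_substitution ::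
    "bool \<Rightarrow> ('i \<Rightarrow> complex set) \<Rightarrow> real \<Rightarrow> ('i \<Rightarrow> 'i tile set) \<Rightarrow> bool" where
  "self_similar_substitution mir T lam \<sigma> \<longleftrightarrow>
     lam > 1 \<and>
     (\<forall>i. compact (T i) \<and> interior (T i) \<noteq> {}) \<and>
     (\<forall>i. finite (\<sigma> i) \<and> \<sigma> i \<subseteq> copies mir \<and> packing T (\<sigma> i) \<and>
          (\<lambda>z. of_real lam * z) ` T i = (\<Union>t\<in>\<sigma> i. support T t))"

text \<open>
  The extension of the substitution to copies:
  \<open>\<sigma>(R\<^sub>\<alpha> T\<^sub>i + t) = R\<^sub>\<alpha> \<sigma>(T\<^sub>i) + \<lambda> t\<close>, and with conjugated \<open>T\<^sub>i\<close> and \<open>\<sigma>(T\<^sub>i)\<close> for mirrored copies.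
\<close>

definition subst_tile :: "real \<Rightarrow> ('i \<Rightarrow> 'i tile set) \<Rightarrow> 'i tile \<Rightarrow> 'i tile set" where
  "subst_tile lam \<sigma> t = move (scale_motion lam (snd t)) ` \<sigma> (fst t)"

definition substitute :: "real \<Rightarrow> ('i \<Rightarrow> 'i tile set) \<Rightarrow> 'i tile set \<Rightarrow> 'i tile set" where
  "substitute lam \<sigma> P = (\<Union>t\<in>P. subst_tile lam \<sigma> t)"

definition supertile :: "real \<Rightarrow> ('i \<Rightarrow> 'i tile set) \<Rightarrow> nat \<Rightarrow> 'i \<Rightarrow> 'i tile set" where
  "supertile lam \<sigma> n i = (substitute lam \<sigma> ^^ n) {(i, id_motion)}"

definition substitution_matrix :: "('i::finite \<Rightarrow> 'i tile set) \<Rightarrow> nat ^ 'i ^ 'i" where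
  "substitution_matrix \<sigma> = (\<chi> i j. card {t \<in> \<sigma> i. tile_type t = j})"

definition primitive :: "('i::finite \<Rightarrow> 'i tile set) \<Rightarrow> bool" where
  "primitive \<sigma> \<longleftrightarrow>
     (\<exists>k\<ge>1. \<forall>i j. (((\<lambda>A. substitution_matrix \<sigma> ** A) ^^ k) (mat 1)) $ i $ j > 0)"

definition substitution_tiling ::
    "bool \<Rightarrow> ('i \<Rightarrow> complex set) \<Rightarrow> real \<Rightarrow> ('i \<Rightarrow> 'i tile set) \<Rightarrow> 'i tile set \<Rightarrow> bool" where
  "substitution_tiling mir T lam \<sigma> X \<longleftrightarrow>
     tiling mir T X \<and>
     (\<forall>P\<subseteq>X. finite P \<longrightarrow>
        (\<exists>n\<ge>1. \<exists>i. \<exists>Q\<subseteq>supertile lam \<sigma> n i. congruent_tiles P Q))"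

definition tiling_space ::
    "bool \<Rightarrow> ('i \<Rightarrow> complex set) \<Rightarrow> real \<Rightarrow> ('i \<Rightarrow> 'i tile set) \<Rightarrow> 'i tile set set" where
  "tiling_space mir T lam \<sigma> = {X. substitution_tiling mir T lam \<sigma> X}"

definition pinwheel_like :: "'i tile set \<Rightarrow> bool" where
  "pinwheel_like X \<longleftrightarrow> infinite (tile_angle ` X)"

text \<open>
  An enumeration (from index 0, without repetition) of the tiles of \<open>X\<close>, arbitrarily long initial
  segments of which are congruent to supertiles.  Not every substitution tiling has one: the plane
  may split into several infinite-order supertiles, and then no increasing sequence of supertiles
  exhausts it.
\<close>

definition supertile_arrangement ::
    "real \<Rightarrow> ('i \<Rightarrow> 'i tile set) \<Rightarrow> 'i tile set \<Rightarrow> (nat \<Rightarrow> 'i tile) \<Rightarrow> bool" where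
  "supertile_arrangement lam \<sigma> X S \<longleftrightarrow>
     bij_betw S UNIV X \<and>
     (\<forall>n\<ge>1. \<exists>l\<ge>n. \<exists>k\<ge>1. \<exists>i. congruent_tiles (S ` {..<l}) (supertile lam \<sigma> k i))"

text \<open>
  The arrangement is existentially quantified: the order of the tiles between two
  consecutive supertile segments is unconstrained, so an unfavourable order (say, by increasing
  angle) destroys the convergence, whatever the tiling.
\<close>

definition statistical_circular_symmetry ::
    "real \<Rightarrow> ('i \<Rightarrow> 'i tile set) \<Rightarrow> 'i tile set \<Rightarrow> bool" where
  "statistical_circular_symmetry lam \<sigma> X \<longleftrightarrow>
     (\<exists>S. supertile_arrangement lam \<sigma> X S \<and>
       (\<forall>x y. 0 \<le> x \<and> x < y \<and> y < 2 * pi \<longrightarrow>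
         (\<lambda>n. (1 / real n) * (\<Sum>j<n. indicat_real {x..y} (tile_angle (S j))))
           \<longlonglongrightarrow> (y - x) / (2 * pi)))"

lemma act_comp_motion: "act (comp_motion g h) z = act g (act h z)"
proof -
  have rm: "cis (a rmod (2 * pi)) = cis a" for a
  proof -
    have "a rmod (2 * pi) = a - 2 * pi * of_int \<lfloor>a / (2 * pi)\<rfloor>"
      by (simp add: rmod_def abs_mult mult.commute)
    then show ?thesis by (simp add: cis_divide[symmetric] cis_multiple_2pi)
  qed
  show ?thesis
    unfolding act_def comp_motion_def motion.sel rm
    by (cases "mirrored g"; cases "mirrored h")
       (simp_all add: cis_mult[symmetric] cis_cnj cis_divide[symmetric] algebra_simps divide_inverse)
qed

lemma support_move: "support T (move g t) = act g ` support T t"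
  by (simp add: support_def move_def image_image act_comp_motion)

lemma normalized_comp_motion: "normalized (comp_motion g h)"
  by (simp add: normalized_def comp_motion_def rmod_less rmod_nonneg)

lemma comp_id_motion: "normalized h \<Longrightarrow> comp_motion id_motion h = h"
  by (simp add: comp_motion_def id_motion_def normalized_def act_def rmod_idem motion.expand)

lemma supertile_1:
  assumes "self_similar_substitution mir T lam \<sigma>"
  shows "supertile lam \<sigma> 1 i = \<sigma> i"
proof -
  have [simp]: "scale_motion lam id_motion = id_motion"
    by (simp add: scale_motion_def id_motion_def)
  have "move id_motion t = t" if "t \<in> \<sigma> i" for t
    using that assms comp_id_motion[of "snd t"]
    by (fastforce simp: self_similar_substitution_def copies_def move_def)
  then show ?thesis
    by (simp add: supertile_def substitute_def subst_tile_def)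
qed

end

theory Submission
  imports Defs
begin

text \<open>
  Fix an integer \<open>k \<noteq> 0\<close> and write \<open>W\<^sub>n(i)\<close> for the sum of \<open>exp(i k \<alpha>(t))\<close> over the tiles \<open>t\<close> of the
  \<open>n\<close>-th supertile of type \<open>i\<close>. Decomposing the \<open>(m + n)\<close>-th supertile into \<open>m\<close>-th supertiles shows that
  \<open>W\<^bsub>m+n\<^esub>(i)\<close> is the sum of \<open>exp(i k \<alpha>(t)) W\<^sub>m(type t)\<close> over the \<open>n\<close>-th supertile, with \<open>W\<^sub>m\<close> conjugated
  for mirrored \<open>t\<close>. A pinwheel-like tiling contains two tiles of the same type and orientation
  with different phases \<open>exp(i k \<alpha>)\<close>; by primitivity such a pair occurs in all supertiles of some
  level, and the two summands it contributes cancel by a fixed proportion. Iterating, \<open>W\<^sub>n(i)\<close> is of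
  smaller order than the number of tiles, so by Weyl's criterion the angles in large supertiles are
  asymptotically equidistributed. This property of \<open>\<sigma>\<close> then applies to every tiling of the tiling space.
  An arrangement of the tiles is finally rearranged between sparse supertile segments by a greedy
  order in which every angular class occurs at a steady rate.
\<close>

section \<open>Balanced orderings\<close>

text \<open>Elements are appended one at a time, always from a class that is not ahead of its
  proportional share. This raises the count of that class by one, which the slack \<open>N\<close>
  on the right absorbs; for all other classes the bound only becomes weaker as \<open>n\<close>
  grows.\<close>

lemma greedy_interleaving:
  fixes c :: "'a \<Rightarrow> 'k"
  assumes A: "finite A" and N: "N = card A" and "p \<le> N"
  shows "\<exists>e. inj_on e {..<p} \<and> e ` {..<p} \<subseteq> A \<and>
           (\<forall>n\<le>p. \<forall>C. card {j. j < n \<and> c (e j) = C} * N \<le> n * card {a\<in>A. c a = C} + N)"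
  using \<open>p \<le> N\<close>
proof (induction p)
  case 0
  then show ?case by simp
next
  case (Suc p)
  then obtain e where inj: "inj_on e {..<p}" and sub: "e ` {..<p} \<subseteq> A"
    and bd: "\<And>n C. n \<le> p \<Longrightarrow> card {j. j < n \<and> c (e j) = C} * N \<le> n * card {a\<in>A. c a = C} + N"
    by auto
  define cnt where "cnt C = card {j. j < p \<and> c (e j) = C}" for C
  define tot where "tot C = card {a\<in>A. c a = C}" for C
  have fin: "finite (c ` A)" using A by simp
  have ne: "c ` A \<noteq> {}" using Suc.prems N A by (metis card.empty image_is_empty not_less_eq_eq le0)
  have tot: "(\<Sum>C\<in>c ` A. tot C) = N"
    using sum.image_gen[OF A, of "\<lambda>_. 1::nat" c] by (simp add: tot_def N)
  have cnt: "(\<Sum>C\<in>c ` A. cnt C) = p"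
  proof -
    have "(\<Sum>C\<in>c ` A. cnt C) = card (\<Union>C\<in>c ` A. {j. j < p \<and> c (e j) = C})"
      unfolding cnt_def by (subst card_UN_disjoint) (use fin in auto)
    also have "(\<Union>C\<in>c ` A. {j. j < p \<and> c (e j) = C}) = {..<p}" using sub by auto
    finally show ?thesis by simp
  qed
  \<comment> \<open>Averaging: summed over all classes, both sides equal \<open>p * N\<close>, so
    not every class can be ahead of its share.\<close>
  have "\<exists>C\<in>c ` A. cnt C * N \<le> p * tot C"
  proof (rule ccontr)
    assume "\<not> ?thesis"
    then have "(\<Sum>C\<in>c ` A. p * tot C) < (\<Sum>C\<in>c ` A. cnt C * N)"
      by (intro sum_strict_mono fin ne) auto
    then show False
      by (simp add: sum_distrib_left[symmetric] sum_distrib_right[symmetric] tot cnt)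
  qed
  then obtain C where C: "C \<in> c ` A" "cnt C * N \<le> p * tot C" by auto
  have "tot C > 0" using C(1) A by (auto simp: tot_def card_gt_0_iff)
  have "cnt C * N < tot C * N"
    using C(2) Suc.prems \<open>tot C > 0\<close>
    by (metis Suc_le_eq le_less_trans mult.commute mult_less_cancel2)
  then have lt: "cnt C < tot C" by simp
  have "\<exists>a\<in>A. c a = C \<and> a \<notin> e ` {..<p}"
  proof (rule ccontr)
    assume "\<not> ?thesis"
    then have "{a\<in>A. c a = C} \<subseteq> e ` {j. j < p \<and> c (e j) = C}" by auto
    then have "tot C \<le> card (e ` {j. j < p \<and> c (e j) = C})"
      unfolding tot_def by (intro card_mono) auto
    also have "\<dots> \<le> cnt C" unfolding cnt_def by (intro card_image_le) auto
    finally have "tot C \<le> cnt C" .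
    with lt show False by simp
  qed
  then obtain a where a: "a \<in> A" "c a = C" "a \<notin> e ` {..<p}" by auto
  let ?e = "e(p := a)"
  have "inj_on ?e {..<Suc p}"
    using inj a(3) by (auto simp: lessThan_Suc inj_on_def)
  moreover have "?e ` {..<Suc p} \<subseteq> A" using sub a(1) by (auto simp: lessThan_Suc)
  moreover have "card {j. j < n \<and> c (?e j) = D} * N \<le> n * card {a\<in>A. c a = D} + N"
    if "n \<le> Suc p" for n D
  proof (cases "n \<le> p")
    case True
    then have "{j. j < n \<and> c (?e j) = D} = {j. j < n \<and> c (e j) = D}" by auto
    then show ?thesis using bd[OF True, of D] by simp
  next
    case False
    then have n: "n = Suc p" using that by simp
    show ?thesis
    proof (cases "D = C")
      case True
      have "{j. j < n \<and> c (?e j) = D} = insert p {j. j < p \<and> c (e j) = C}"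
        using True n a(2) by auto
      then have "card {j. j < n \<and> c (?e j) = D} = Suc (cnt C)" by (simp add: cnt_def)
      then show ?thesis using C(2) by (simp add: True n tot_def)
    next
      case False
      then have "{j. j < n \<and> c (?e j) = D} = {j. j < p \<and> c (e j) = D}"
        using n a(2) by (auto simp: less_Suc_eq)
      then show ?thesis using bd[of p D] by (simp add: n)
    qed
  qed
  ultimately show ?case by blast
qed

text \<open>
  The greedy order only bounds the surplus of every class; since the surpluses sum to zero, this
  also bounds the deficit of every union of classes.
\<close>

lemma interleaving:
  fixes c :: "'a \<Rightarrow> 'k"
  assumes A: "finite A" and K: "finite K" "c ` A \<subseteq> K"
  shows "\<exists>e. bij_betw e {..<card A} A \<and>
           (\<forall>n\<le>card A. \<forall>D. \<bar>real (card {j. j < n \<and> c (e j) \<in> D})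
              - real n / real (card A) * real (card {a\<in>A. c a \<in> D})\<bar> \<le> real (card K))"
proof -
  define N where "N = card A"
  obtain e where inj: "inj_on e {..<N}" and sub: "e ` {..<N} \<subseteq> A"
    and bd: "\<And>n C. n \<le> N \<Longrightarrow> card {j. j < n \<and> c (e j) = C} * N \<le> n * card {a\<in>A. c a = C} + N"
    using greedy_interleaving[OF A N_def, of N c] by auto
  have im: "e ` {..<N} = A"
    using sub A inj by (intro card_subset_eq) (auto simp: card_image N_def)
  define dev where "dev n D = real (card {j. j < n \<and> c (e j) \<in> D})
              - real n / real N * real (card {a\<in>A. c a \<in> D})" for n D
  have upper: "dev n D \<le> real (card K)" if n: "n \<le> N" for n D
  proof (cases "N = 0")
    case True
    then show ?thesis using n by (simp add: dev_def)
  next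
    case False
    \<comment> \<open>\<open>D\<close> is an arbitrary, possibly infinite set of classes;
      intersecting with \<open>K\<close> makes it a finite union and bounds the number of summands
      by \<open>card K\<close>.\<close>
    have 1: "card {j. j < n \<and> c (e j) \<in> D} = (\<Sum>C\<in>K \<inter> D. card {j. j < n \<and> c (e j) = C})"
    proof -
      have "{j. j < n \<and> c (e j) \<in> D} = (\<Union>C\<in>K \<inter> D. {j. j < n \<and> c (e j) = C})"
        using sub K(2) n by fastforce
      then show ?thesis using K(1) by (simp add: card_UN_disjoint disjoint_iff)
    qed
    have 2: "card {a\<in>A. c a \<in> D} = (\<Sum>C\<in>K \<inter> D. card {a\<in>A. c a = C})"
    proof -
      have "{a\<in>A. c a \<in> D} = (\<Union>C\<in>K \<inter> D. {a\<in>A. c a = C})"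
        using K(2) by auto
      then show ?thesis using K(1) A by (simp add: card_UN_disjoint disjoint_iff)
    qed
    have 3: "real (card {j. j < n \<and> c (e j) = C}) - real n / real N * real (card {a\<in>A. c a = C}) \<le> 1" for C
    proof -
      have "real (card {j. j < n \<and> c (e j) = C}) * real N
            \<le> real n * real (card {a\<in>A. c a = C}) + real N"
        using of_nat_mono[OF bd[OF n, of C], where 'a = real] by simp
      then show ?thesis using False by (simp add: field_simps)
    qed
    have "dev n D = (\<Sum>C\<in>K \<inter> D. real (card {j. j < n \<and> c (e j) = C})
        - real n / real N * real (card {a\<in>A. c a = C}))"
      by (simp add: dev_def 1 2 sum_subtractf sum_distrib_left)
    also have "\<dots> \<le> (\<Sum>C\<in>K \<inter> D. 1)" by (intro sum_mono 3)
    also have "\<dots> \<le> real (card K)" using K(1) by (simp add: card_mono)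
    finally show ?thesis .
  qed
  have "dev n D + dev n (- D) = 0" if "n \<le> N" for n D
  proof (cases "N = 0")
    case True
    then show ?thesis using that by (simp add: dev_def)
  next
    case False
    have "card {j. j < n \<and> c (e j) \<in> D} + card {j. j < n \<and> c (e j) \<in> - D}
        = card ({j. j < n \<and> c (e j) \<in> D} \<union> {j. j < n \<and> c (e j) \<in> - D})"
      by (subst card_Un_disjoint) auto
    also have "{j. j < n \<and> c (e j) \<in> D} \<union> {j. j < n \<and> c (e j) \<in> - D} = {..<n}" by auto
    finally have 1: "real (card {j. j < n \<and> c (e j) \<in> D}) + real (card {j. j < n \<and> c (e j) \<in> - D}) = real n"
      by simp
    have "card {a\<in>A. c a \<in> D} + card {a\<in>A. c a \<in> - D} = card ({a\<in>A. c a \<in> D} \<union> {a\<in>A. c a \<in> - D})"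
      using A by (subst card_Un_disjoint) auto
    also have "{a\<in>A. c a \<in> D} \<union> {a\<in>A. c a \<in> - D} = A" by auto
    finally have 2: "real (card {a\<in>A. c a \<in> D}) + real (card {a\<in>A. c a \<in> - D}) = real N"
      by (simp add: N_def flip: of_nat_add)
    have "dev n D + dev n (- D)
        = (real (card {j. j < n \<and> c (e j) \<in> D}) + real (card {j. j < n \<and> c (e j) \<in> - D}))
          - real n / real N * (real (card {a\<in>A. c a \<in> D}) + real (card {a\<in>A. c a \<in> - D}))"
      unfolding dev_def distrib_left by simp
    also have "\<dots> = real n - real n / real N * real N"
      unfolding 1 2 ..
    finally show ?thesis using False by simp
  qed
  then have "\<bar>dev n D\<bar> \<le> real (card K)" if "n \<le> N" for n D
    using upper[OF that, of D] upper[OF that, of "- D"] that by (smt (verit))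
  moreover have "bij_betw e {..<card A} A" using inj im by (simp add: bij_betw_def N_def)
  ultimately show ?thesis unfolding dev_def N_def by blast
qed

text \<open>Bijections of the consecutive blocks \<open>{l r..<l (Suc r)}\<close> are glued to one
  permutation of the naturals. As every block is mapped to itself, the initial segments that end at
  block boundaries are preserved as sets.\<close>

lemma reorder_blocks:
  fixes l :: "nat \<Rightarrow> nat"
  assumes l: "strict_mono l" "l 0 = 0"
    and e: "\<And>r. bij_betw (e r) {..<l (Suc r) - l r} {l r..<l (Suc r)}"
  obtains \<pi> where "bij \<pi>" "\<And>r. \<pi> ` {..<l r} = {..<l r}"
    "\<And>r j. l r + j < l (Suc r) \<Longrightarrow> \<pi> (l r + j) = e r j"
proof -
  have ex: "\<exists>r. l r \<le> j \<and> j < l (Suc r)" for j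
  proof (induction j)
    case 0
    then show ?case using l by (metis le0 le_numeral_extra(3) lessI strict_monoD)
  next
    case (Suc j)
    then obtain r where r: "l r \<le> j" "j < l (Suc r)" by auto
    show ?case
    proof (cases "Suc j < l (Suc r)")
      case True
      then show ?thesis using r by (intro exI[of _ r]) auto
    next
      case False
      then have "l (Suc r) = Suc j" using r by simp
      then show ?thesis using l(1) by (metis le_refl lessI strict_monoD)
    qed
  qed
  have uniq: "r = r'" if "l r \<le> j" "j < l (Suc r)" "l r' \<le> j" "j < l (Suc r')" for r r' j
    using that l(1) by (meson leD le_less_trans less_Suc_eq_le linorder_neqE_nat order_less_le_trans strict_mono_less Suc_leI strict_mono_less_eq)
  define idx where "idx j = (THE r. l r \<le> j \<and> j < l (Suc r))" for j
  have idx: "idx j = r" if "l r \<le> j" "j < l (Suc r)" for r j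
    unfolding idx_def using that uniq by blast
  define \<pi> where "\<pi> j = e (idx j) (j - l (idx j))" for j
  have pi: "\<pi> (l r + j) = e r j" if "l r + j < l (Suc r)" for r j
    using idx[of r "l r + j"] that by (simp add: \<pi>_def)
  have block: "bij_betw \<pi> {l r..<l (Suc r)} {l r..<l (Suc r)}" for r
  proof -
    have sh: "bij_betw (\<lambda>j. j - l r) {l r..<l (Suc r)} {..<l (Suc r) - l r}"
      by (rule bij_betw_byWitness[where f' = "\<lambda>j. l r + j"]) auto
    have "bij_betw (e r \<circ> (\<lambda>j. j - l r)) {l r..<l (Suc r)} {l r..<l (Suc r)}"
      using bij_betw_trans[OF sh e] .
    then show ?thesis
      by (rule bij_betw_cong[THEN iffD1, rotated]) (auto simp: \<pi>_def idx)
  qed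
  have pre: "bij_betw \<pi> {..<l r} {..<l r}" for r
  proof (induction r)
    case 0
    then show ?case by (simp add: l(2) bij_betw_def)
  next
    case (Suc r)
    have "{..<l (Suc r)} = {..<l r} \<union> {l r..<l (Suc r)}"
      using l(1) by (simp add: ivl_disj_un_one(2) strict_mono_less_eq)
    moreover have "bij_betw \<pi> ({..<l r} \<union> {l r..<l (Suc r)}) ({..<l r} \<union> {l r..<l (Suc r)})"
      by (rule bij_betw_combine[OF Suc block]) auto
    ultimately show ?case by simp
  qed
  have big: "j < l (Suc j)" for j
    using strict_mono_imp_increasing[OF l(1), of "Suc j"] by simp
  have "inj \<pi>"
  proof (rule injI)
    fix x y assume eq: "\<pi> x = \<pi> y"
    have "x < l (Suc (max x y))" "y < l (Suc (max x y))"
      using big[of "max x y"] by auto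
    then show "x = y" using pre[of "Suc (max x y)"] eq by (auto simp: bij_betw_def inj_on_def)
  qed
  moreover have "surj \<pi>"
    by (metis big bij_betw_imp_surj_on imageE lessThan_iff pre surjI surj_def)
  ultimately have "bij \<pi>" by (rule bijI)
  then show ?thesis using that[of \<pi>] pi pre by (auto simp: bij_betw_def)
qed

text \<open>Frequencies known only along the lengths in \<open>L\<close> become frequencies along
  all lengths. A sparse sequence of lengths in \<open>L\<close> cuts the naturals into blocks, and
  block \<open>r\<close> is interleaved evenly with respect to the first \<open>r\<close> sets
  \<open>B s\<close>. Every set is eventually among those, so countably many sets are handled at
  once.\<close>

lemma balanced_reordering:
  fixes L :: "nat set" and B :: "nat \<Rightarrow> nat set" and q :: "nat \<Rightarrow> real"
  assumes L: "infinite L"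
    and freq: "\<And>s \<epsilon>. \<epsilon> > 0 \<Longrightarrow>
      \<exists>N. \<forall>l\<in>L. l \<ge> N \<longrightarrow> \<bar>real (card {j. j < l \<and> j \<in> B s}) - q s * real l\<bar> \<le> \<epsilon> * real l"
  obtains \<pi> where "bij \<pi>" "\<And>n. \<exists>l\<in>L. l \<ge> n \<and> \<pi> ` {..<l} = {..<l}"
    "\<And>s. (\<lambda>n. real (card {j. j < n \<and> \<pi> j \<in> B s}) / real n) \<longlonglongrightarrow> q s"
proof -
  define dev where "dev l s = real (card {j. j < l \<and> j \<in> B s}) - q s * real l" for l s
  have "\<exists>N. \<forall>l\<in>L. l \<ge> N \<longrightarrow> (\<forall>s<r. \<bar>dev l s\<bar> \<le> real l / 2 ^ r)" for r
  proof -
    have "\<exists>N. \<forall>l\<in>L. l \<ge> N \<longrightarrow> \<bar>dev l s\<bar> \<le> real l / 2 ^ r" for s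
      using freq[of "1 / 2 ^ r" s] by (simp add: dev_def)
    then obtain N where "\<And>s l. l \<in> L \<Longrightarrow> l \<ge> N s \<Longrightarrow> \<bar>dev l s\<bar> \<le> real l / 2 ^ r" by metis
    \<comment> \<open>One threshold serves the first \<open>r\<close> sets. For \<open>r = 0\<close>
      the value of \<open>Max\<close> is unspecified, but the claim is then vacuous.\<close>
    then show ?thesis
      by (intro exI[of _ "Max (N ` {..<r})"] ballI impI allI)
         (metis Max.bounded_iff finite_imageI finite_lessThan imageI image_is_empty lessThan_iff empty_iff)
  qed
  then obtain N where N: "\<And>r l s. l \<in> L \<Longrightarrow> l \<ge> N r \<Longrightarrow> s < r \<Longrightarrow> \<bar>dev l s\<bar> \<le> real l / 2 ^ r"
    by metis
  have next_len: "\<exists>l\<in>L. l \<ge> b" for b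
    using L by (meson infinite_nat_iff_unbounded_le)
  \<comment> \<open>Three growth conditions: the threshold \<open>N\<close> controls the deviations
    at block ends, the power of 4 dominates the interleaving error, and the doubling makes each
    block at least half of the segment that it completes.\<close>
  have "\<exists>l. l 0 = (0::nat) \<and> (\<forall>r. l (Suc r) \<in> L \<and> N (Suc r) \<le> l (Suc r) \<and> 4 ^ Suc r \<le> l (Suc r)
            \<and> 2 * l r + 1 \<le> l (Suc r))"
  proof -
    define step where "step r b = (SOME l. l \<in> L \<and> l \<ge> Max {N (Suc r), 4 ^ Suc r, 2 * b + 1})" for r b
    have "step r b \<in> L \<and> step r b \<ge> Max {N (Suc r), 4 ^ Suc r, 2 * b + 1}" for r b
      unfolding step_def by (rule someI_ex) (use next_len in blast)
    then show ?thesis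
      by (intro exI[of _ "rec_nat 0 step"]) simp
  qed
  then obtain l where l0: "l 0 = (0::nat)"
    and lS: "\<And>r. l (Suc r) \<in> L" "\<And>r. N (Suc r) \<le> l (Suc r)" "\<And>r. 4 ^ Suc r \<le> l (Suc r)"
      "\<And>r. 2 * l r + 1 \<le> l (Suc r)"
    by blast
  have mono: "strict_mono l"
    unfolding strict_mono_Suc_iff
  proof
    show "l r < l (Suc r)" for r using lS(4)[of r] by linarith
  qed
  have dev_l: "\<bar>dev (l r) s\<bar> \<le> real (l r) / 2 ^ r" if "s < r" for r s
    using N[OF lS(1,2)] that by (cases r) auto
  define A where "A r = {l r..<l (Suc r)}" for r
  \<comment> \<open>The class of \<open>j\<close> records its membership in the first
    \<open>r\<close> sets. There are at most \<open>2 ^ r\<close> classes, which bounds the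
    interleaving error in block \<open>r\<close>.\<close>
  define c where "c r j = {s. s < r \<and> j \<in> B s}" for r j
  have "\<exists>e. bij_betw e {..<card (A r)} (A r) \<and>
           (\<forall>n\<le>card (A r). \<forall>D. \<bar>real (card {j. j < n \<and> c r (e j) \<in> D})
              - real n / real (card (A r)) * real (card {a\<in>A r. c r a \<in> D})\<bar> \<le> real (card (Pow {..<r})))"
    for r
    by (rule interleaving) (auto simp: A_def c_def)
  then obtain e where "\<And>r. bij_betw (e r) {..<card (A r)} (A r) \<and>
           (\<forall>n\<le>card (A r). \<forall>D. \<bar>real (card {j. j < n \<and> c r (e r j) \<in> D})
              - real n / real (card (A r)) * real (card {a\<in>A r. c r a \<in> D})\<bar> \<le> real (card (Pow {..<r})))"
    using choice[of "\<lambda>r e. bij_betw e {..<card (A r)} (A r) \<and>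
           (\<forall>n\<le>card (A r). \<forall>D. \<bar>real (card {j. j < n \<and> c r (e j) \<in> D})
              - real n / real (card (A r)) * real (card {a\<in>A r. c r a \<in> D})\<bar> \<le> real (card (Pow {..<r})))"]
    by blast
  then have e: "\<And>r. bij_betw (e r) {..<l (Suc r) - l r} {l r..<l (Suc r)}"
    and e_dev: "\<And>r n D. n \<le> l (Suc r) - l r \<Longrightarrow> \<bar>real (card {j. j < n \<and> c r (e r j) \<in> D})
              - real n / real (l (Suc r) - l r) * real (card {a\<in>A r. c r a \<in> D})\<bar> \<le> 2 ^ r"
    by (simp_all add: A_def card_Pow)
  obtain \<pi> where pi: "bij \<pi>" "\<And>r. \<pi> ` {..<l r} = {..<l r}"
    "\<And>r j. l r + j < l (Suc r) \<Longrightarrow> \<pi> (l r + j) = e r j"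
    using reorder_blocks[OF mono l0 e] by metis
  have count_prefix: "card {j. j < l r \<and> \<pi> j \<in> B s} = card {j. j < l r \<and> j \<in> B s}" for r s
  proof -
    have "\<pi> ` {j. j < l r \<and> \<pi> j \<in> B s} = \<pi> ` {..<l r} \<inter> B s" by auto
    also have "\<dots> = {j. j < l r \<and> j \<in> B s}" unfolding pi(2) by auto
    finally show ?thesis
      by (metis card_image bij_is_inj inj_on_subset pi(1) subset_UNIV)
  qed
  have main: "\<bar>real (card {j. j < n \<and> \<pi> j \<in> B s}) - q s * real n\<bar> \<le> 4 * real n / 2 ^ r"
    if r: "s < r" and n: "l r \<le> n" "n < l (Suc r)" for r s n
  proof -
    define p where "p = n - l r"
    define a where "a = l (Suc r) - l r"
    have n': "n = l r + p" using n by (simp add: p_def)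
    have pa: "p < a" "l (Suc r) = l r + a" "l (Suc r) \<le> 2 * a" using n lS(4)[of r] by (auto simp: p_def a_def)
    \<comment> \<open>The bound fails for \<open>r = 0\<close>, where \<open>l 0 = 0\<close>; that
      case is excluded by \<open>s < r\<close>.\<close>
    have r4: "4 ^ r \<le> l r" using lS(3) r by (cases r) auto
    have "{j. j < n \<and> \<pi> j \<in> B s} = {j. j < l r \<and> \<pi> j \<in> B s} \<union> (\<lambda>j. l r + j) ` {j. j < p \<and> e r j \<in> B s}"
      (is "_ = ?U \<union> ?V")
    proof (intro set_eqI iffI)
      fix j assume j: "j \<in> {j. j < n \<and> \<pi> j \<in> B s}"
      show "j \<in> ?U \<union> ?V"
      proof (cases "j < l r")
        case False
        then have "j = l r + (j - l r)" "j - l r < p" using j by (auto simp: n')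
        moreover have "e r (j - l r) \<in> B s" using pi(3)[of r "j - l r"] False j n by auto
        ultimately show ?thesis by blast
      qed (use j in auto)
    next
      fix j assume "j \<in> ?U \<union> ?V"
      then show "j \<in> {j. j < n \<and> \<pi> j \<in> B s}" using pi(3)[of r] n by (auto simp: n')
    qed
    then have "card {j. j < n \<and> \<pi> j \<in> B s} = card (?U \<union> ?V)" by simp
    also have "\<dots> = card ?U + card ?V" by (intro card_Un_disjoint) auto
    also have "card ?V = card {j. j < p \<and> e r j \<in> B s}" by (intro card_image) auto
    finally have split_n: "card {j. j < n \<and> \<pi> j \<in> B s}
      = card {j. j < l r \<and> j \<in> B s} + card {j. j < p \<and> e r j \<in> B s}"
      by (simp add: count_prefix)
    define b where "b = card {j\<in>A r. j \<in> B s}"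
    have "{j. j < l (Suc r) \<and> j \<in> B s} = {j. j < l r \<and> j \<in> B s} \<union> {j\<in>A r. j \<in> B s}"
      using pa(2) by (auto simp: A_def)
    also have "card \<dots> = card {j. j < l r \<and> j \<in> B s} + b"
      unfolding b_def by (intro card_Un_disjoint) (auto simp: A_def)
    finally have "card {j. j < l (Suc r) \<and> j \<in> B s} = card {j. j < l r \<and> j \<in> B s} + b" .
    then have b: "real b - q s * real a = dev (l (Suc r)) s - dev (l r) s"
      by (simp add: dev_def pa algebra_simps)
    have c: "s \<in> c r j \<longleftrightarrow> j \<in> B s" for j using r by (simp add: c_def)
    have "p \<le> l (Suc r) - l r" using pa(1) by (simp add: a_def)
    from e_dev[OF this, of "{D. s \<in> D}"]
    have e1: "\<bar>real (card {j. j < p \<and> e r j \<in> B s}) - real p / real a * real b\<bar> \<le> 2 ^ r"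
      by (simp add: b_def c flip: a_def)
    \<comment> \<open>By the doubling condition \<open>l (Suc r)\<close> is at most
      \<open>2 * a\<close>; the factor 2 is cancelled by the exponent \<open>Suc r\<close>.\<close>
    have "real p / real a * \<bar>dev (l (Suc r)) s\<bar> \<le> real p / real a * (2 * real a / 2 ^ Suc r)"
    proof (intro mult_left_mono)
      have "real (l (Suc r)) \<le> 2 * real a" using pa(3) by linarith
      then show "\<bar>dev (l (Suc r)) s\<bar> \<le> 2 * real a / 2 ^ Suc r"
        using dev_l[of s "Suc r"] r by (smt (verit) divide_right_mono less_SucI zero_le_power)
    qed auto
    also have "\<dots> = real p / 2 ^ r" using pa by simp
    finally have e2: "real p / real a * \<bar>dev (l (Suc r)) s\<bar> \<le> real p / 2 ^ r" .
    have "real p / real a * \<bar>dev (l r) s\<bar> \<le> 1 * \<bar>dev (l r) s\<bar>"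
      using pa by (intro mult_right_mono) auto
    then have e3: "real p / real a * \<bar>dev (l r) s\<bar> \<le> real (l r) / 2 ^ r" using dev_l[OF r] by simp
    have "\<bar>real p / real a * (real b - q s * real a)\<bar>
        = real p / real a * \<bar>dev (l (Suc r)) s - dev (l r) s\<bar>"
      unfolding b by (simp add: abs_mult)
    also have "\<dots> \<le> real p / real a * (\<bar>dev (l (Suc r)) s\<bar> + \<bar>dev (l r) s\<bar>)"
      by (intro mult_left_mono) auto
    finally have "\<bar>real p / real a * (real b - q s * real a)\<bar>
        \<le> real p / real a * \<bar>dev (l (Suc r)) s\<bar> + real p / real a * \<bar>dev (l r) s\<bar>"
      unfolding distrib_left .
    then have e4: "\<bar>real p / real a * (real b - q s * real a)\<bar> \<le> real p / 2 ^ r + real (l r) / 2 ^ r"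
      using e2 e3 by linarith
    have "(2::real) ^ r = 4 ^ r / 2 ^ r" by (simp flip: power_divide)
    also have "\<dots> \<le> real (l r) / 2 ^ r"
      using r4 by (intro divide_right_mono) (auto simp: numeral_power_le_of_nat_cancel_iff)
    finally have e5: "(2::real) ^ r \<le> real (l r) / 2 ^ r" .
    \<comment> \<open>Three sources of error: the deviation at the start of the block, the
      unevenness within the block, and the deviation of the whole block scaled to the part
      \<open>p / a\<close> that has been passed.\<close>
    have "real (card {j. j < n \<and> \<pi> j \<in> B s}) - q s * real n
      = dev (l r) s + (real (card {j. j < p \<and> e r j \<in> B s}) - real p / real a * real b)
        + real p / real a * (real b - q s * real a)"
      unfolding split_n using pa(1) by (simp add: dev_def n' algebra_simps)
    moreover have "\<bar>x\<bar> \<le> x' + y' + z'"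
      if "x = u + v + w" "\<bar>u\<bar> \<le> x'" "\<bar>v\<bar> \<le> y'" "\<bar>w\<bar> \<le> z'" for x u v w x' y' z' :: real
      using that by linarith
    ultimately have "\<bar>real (card {j. j < n \<and> \<pi> j \<in> B s}) - q s * real n\<bar>
      \<le> real (l r) / 2 ^ r + real (l r) / 2 ^ r + (real p / 2 ^ r + real (l r) / 2 ^ r)"
      using dev_l[OF r] order_trans[OF e1 e5] e4 by blast
    also have "\<dots> \<le> 4 * real n / 2 ^ r"
      by (simp add: n' field_simps)
    finally show ?thesis .
  qed
  show ?thesis
  proof (rule that[OF pi(1)])
    fix n
    have "n \<le> l (Suc n)" using strict_mono_imp_increasing[OF mono, of "Suc n"] by simp
    then show "\<exists>l\<in>L. l \<ge> n \<and> \<pi> ` {..<l} = {..<l}" using lS(1) pi(2) by blast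
  next
    fix s
    show "(\<lambda>n. real (card {j. j < n \<and> \<pi> j \<in> B s}) / real n) \<longlonglongrightarrow> q s"
    proof (rule LIMSEQ_I)
      fix \<epsilon> :: real assume "\<epsilon> > 0"
      then obtain r1 where r1: "(1/2) ^ r1 < \<epsilon> / 4"
        using real_arch_pow_inv[of "\<epsilon>/4" "1/2"] by auto
      \<comment> \<open>The first entry makes the error small, the second ensures that
        \<open>B s\<close> is among the sets balanced in the block.\<close>
      define r0 where "r0 = max r1 (Suc s)"
      have r0: "4 / 2 ^ r < \<epsilon>" if "r \<ge> r0" for r
      proof -
        have "(1/2::real) ^ r \<le> (1/2) ^ r1" using that by (intro power_decreasing) (auto simp: r0_def)
        then have "4 * (1/2) ^ r < \<epsilon>" using r1 by linarith
        then show ?thesis by (simp add: power_one_over)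
      qed
      show "\<exists>no. \<forall>n\<ge>no. norm (real (card {j. j < n \<and> \<pi> j \<in> B s}) / real n - q s) < \<epsilon>"
      proof (intro exI allI impI)
        fix n assume n: "n \<ge> l r0"
        \<comment> \<open>The block that contains \<open>n\<close> is the one ending at
          \<open>l k\<close>; as \<open>k > r0\<close>, it has a predecessor boundary
          \<open>l r\<close> with \<open>r \<ge> r0\<close>.\<close>
        define k where "k = (LEAST k. n < l k)"
        have "n < l (Suc n)" using strict_mono_imp_increasing[OF mono, of "Suc n"] by simp
        then have k: "n < l k" unfolding k_def by (rule LeastI)
        have "r0 < k"
          using n k strict_mono_less[OF mono, of r0 k] by simp
        then obtain r where r: "k = Suc r" "r0 \<le> r" by (cases k) auto
        have "s < r" using r(2) by (simp add: r0_def)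
        have "\<not> n < l r" by (rule not_less_Least) (simp add: r(1) flip: k_def)
        then have ln: "l r \<le> n" "n < l (Suc r)" using k r by auto
        have "n > 0" using strict_mono_imp_increasing[OF mono, of r] \<open>s < r\<close> ln(1) by simp
        have "\<bar>real (card {j. j < n \<and> \<pi> j \<in> B s}) - q s * real n\<bar> < \<epsilon> * real n"
        proof -
          have "4 * real n / 2 ^ r < \<epsilon> * real n"
            using mult_strict_right_mono[OF r0[OF r(2)], of "real n"] \<open>n > 0\<close> by simp
          then show ?thesis using main[OF \<open>s < r\<close> ln] by linarith
        qed
        moreover have "real (card {j. j < n \<and> \<pi> j \<in> B s}) / real n - q s
          = (real (card {j. j < n \<and> \<pi> j \<in> B s}) - q s * real n) / real n"
          using \<open>n > 0\<close> by (simp add: field_simps)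
        ultimately show "norm (real (card {j. j < n \<and> \<pi> j \<in> B s}) / real n - q s) < \<epsilon>"
          using \<open>n > 0\<close> by (simp add: abs_divide pos_divide_less_eq)
      qed
    qed
  qed
qed

section \<open>Weyl equidistribution on arcs\<close>

text \<open>\<open>M\<close> is both the mean of \<open>f\<close> over a full period and the limit
  of its averages over the sets \<open>P r\<close>. Keeping the two in one predicate lets linear
  combinations of test functions carry both.\<close>

definition has_mean :: "('b \<Rightarrow> real) \<Rightarrow> (nat \<Rightarrow> 'b set) \<Rightarrow> (real \<Rightarrow> real) \<Rightarrow> real \<Rightarrow> bool" where
  "has_mean a P f M \<longleftrightarrow> (f has_integral 2 * pi * M) {-pi..pi} \<and>
     (\<lambda>r. (\<Sum>t\<in>P r. f (a t)) / real (card (P r))) \<longlonglongrightarrow> M"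

lemma has_mean_add:
  assumes "has_mean a P f M" "has_mean a P g N"
  shows "has_mean a P (\<lambda>x. f x + g x) (M + N)"
  using assms unfolding has_mean_def sum.distrib add_divide_distrib distrib_left
  by (auto intro: has_integral_add tendsto_add)

lemma has_mean_cmult:
  assumes "has_mean a P f M"
  shows "has_mean a P (\<lambda>x. c * f x) (c * M)"
proof -
  have "((\<lambda>x. c * f x) has_integral c * (2 * pi * M)) {-pi..pi}"
    using assms has_integral_mult_right[of f "2 * pi * M" "{-pi..pi}" c] unfolding has_mean_def by blast
  moreover have "(\<lambda>r. c * ((\<Sum>t\<in>P r. f (a t)) / real (card (P r)))) \<longlonglongrightarrow> c * M"
    using assms unfolding has_mean_def by (intro tendsto_mult_left) auto
  ultimately show ?thesis
    by (simp add: has_mean_def sum_distrib_left mult_ac)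
qed

lemma has_mean_sum:
  assumes "finite I" "\<And>i. i \<in> I \<Longrightarrow> has_mean a P (f i) (M i)"
  shows "has_mean a P (\<lambda>x. \<Sum>i\<in>I. f i x) (\<Sum>i\<in>I. M i)"
  using assms
proof (induction I rule: finite_induct)
  case empty
  then show ?case by (simp add: has_mean_def)
next
  case (insert i I)
  then show ?case by (simp add: has_mean_add)
qed

text \<open>The hypothesis of Weyl's criterion: all nontrivial characters of the circle average to 0
  along \<open>P\<close>. Nonempty sets keep the averages clear of division by zero.\<close>

locale equidistributing =
  fixes a :: "'b \<Rightarrow> real" and P :: "nat \<Rightarrow> 'b set"
  assumes fin: "\<And>r. finite (P r)" and ne: "\<And>r. P r \<noteq> {}"
    and characters: "\<And>k::int. k \<noteq> 0 \<Longrightarrow>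
      (\<lambda>r. (\<Sum>t\<in>P r. cis (of_int k * a t)) / of_nat (card (P r))) \<longlonglongrightarrow> 0"
begin

lemma card_pos: "card (P r) > 0"
  using fin ne by (simp add: card_gt_0_iff)

text \<open>A rotation multiplies every character average by a constant phase. It reduces arcs in
  general position to arcs centred at angle 0.\<close>

lemma shift: "equidistributing (\<lambda>t. a t - \<theta>) P"
proof
  fix k :: int assume k: "k \<noteq> 0"
  have eq: "(\<Sum>t\<in>P r. cis (of_int k * (a t - \<theta>))) / of_nat (card (P r))
    = cis (- of_int k * \<theta>) * ((\<Sum>t\<in>P r. cis (of_int k * a t)) / of_nat (card (P r)))" for r
    by (simp add: sum_distrib_left cis_mult algebra_simps)
  show "(\<lambda>r. (\<Sum>t\<in>P r. cis (of_int k * (a t - \<theta>))) / of_nat (card (P r))) \<longlonglongrightarrow> 0"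
    unfolding eq using tendsto_mult_left[OF characters[OF k]] by simp
qed (fact fin ne)+

text \<open>For \<open>k \<noteq> 0\<close> the integral vanishes because
  \<open>sin (k * pi) = 0\<close>, and the averages are real parts of character averages.\<close>

lemma has_mean_cos: "has_mean a P (\<lambda>x. cos (of_int k * x)) (if k = 0 then 1 else 0)"
proof (cases "k = 0")
  case True
  have "((\<lambda>x::real. 1::real) has_integral 2 * pi) {-pi..pi}"
    using has_integral_const_real[of "1::real" "-pi" pi] by simp
  moreover have "real (card (P r)) / real (card (P r)) = 1" for r using card_pos[of r] by simp
  ultimately show ?thesis using True by (simp add: has_mean_def)
next
  case False
  have "((\<lambda>x. cos (of_int k * x)) has_integral
      sin (of_int k * pi) / of_int k - sin (of_int k * (-pi)) / of_int k) {-pi..pi}"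
    using False by (intro fundamental_theorem_of_calculus)
      (auto intro!: derivative_eq_intros simp flip: has_real_derivative_iff_has_vector_derivative)
  moreover have "sin (of_int k * pi) = 0" by (simp add: sin_times_pi_eq_0 mult.commute)
  ultimately have 1: "((\<lambda>x. cos (of_int k * x)) has_integral 0) {-pi..pi}" by simp
  have "(\<lambda>r. Re ((\<Sum>t\<in>P r. cis (of_int k * a t)) / of_nat (card (P r)))) \<longlonglongrightarrow> Re 0"
    by (intro tendsto_Re characters False)
  then have "(\<lambda>r. (\<Sum>t\<in>P r. cos (of_int k * a t)) / real (card (P r))) \<longlonglongrightarrow> 0" by simp
  with 1 show ?thesis using False by (simp add: has_mean_def)
qed

text \<open>Iterating the identity \<open>2 cos x cos kx = cos (k + 1)x + cos (k - 1)x\<close>.\<close>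

lemma has_mean_cos_power: "\<exists>M. has_mean a P (\<lambda>x. cos x ^ n * cos (of_int k * x)) M"
proof (induction n arbitrary: k)
  case 0
  then show ?case using has_mean_cos by auto
next
  case (Suc n)
  obtain M N where M: "has_mean a P (\<lambda>x. cos x ^ n * cos (of_int (k + 1) * x)) M"
    and N: "has_mean a P (\<lambda>x. cos x ^ n * cos (of_int (k - 1) * x)) N"
    using Suc by blast
  have "cos x ^ Suc n * cos (of_int k * x)
    = (1/2) * (cos x ^ n * cos (of_int (k + 1) * x) + cos x ^ n * cos (of_int (k - 1) * x))" for x :: real
  proof -
    have "cos (of_int (k + 1) * x) + cos (of_int (k - 1) * x) = 2 * (cos x * cos (of_int k * x))"
      by (simp add: distrib_right left_diff_distrib cos_add cos_diff)
    then show ?thesis by (simp flip: distrib_left)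
  qed
  then show ?case
    using has_mean_cmult[OF has_mean_add[OF M N], of "1/2"] by (auto simp only:)
qed

text \<open>The condition \<open>cos (a t) \<ge> cos w\<close> describes the arc of half-width
  \<open>w\<close> about 0. Its indicator is majorized by a polynomial in the cosine whose mean is
  known and barely exceeds \<open>w / pi\<close>. Only an upper bound is sought here; lower bounds
  will follow by complementation.\<close>

lemma arc_upper_bound:
  assumes w: "0 < w" "w < pi" and "\<epsilon> > 0"
  shows "\<forall>\<^sub>F r in sequentially. real (card {t \<in> P r. cos (a t) \<ge> cos w}) / real (card (P r)) < w / pi + \<epsilon>"
proof -
  \<comment> \<open>The widened arc stays within half-width \<open>pi\<close>, where the cosine is
    monotone, and the widening costs at most \<epsilon>/4 in the mean.\<close>
  define \<delta> where "\<delta> = min (pi - w) (pi * \<epsilon> / 4)"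
  have d: "\<delta> > 0" "w + \<delta> \<le> pi" "\<delta> / pi \<le> \<epsilon> / 4"
    using w \<open>\<epsilon> > 0\<close> by (auto simp: \<delta>_def min_def field_simps)
  define A where "A = cos w"
  define B where "B = cos (w + \<delta>)"
  have AB: "B < A" unfolding A_def B_def using w d by (intro cos_monotone_0_pi) auto
  \<comment> \<open>A ramp in the variable \<open>u = cos x\<close>: it is 1 from \<open>A\<close>
    upward and 0 below \<open>B\<close>. Being continuous, it has a uniform polynomial approximation
    \<open>g\<close> by the Weierstrass theorem.\<close>
  define h where "h u = max 0 (min 1 ((u - B) / (A - B)))" for u :: real
  have "continuous_on {-1..1} h" unfolding h_def using AB by (intro continuous_intros) auto
  then obtain g where g: "real_polynomial_function g" "\<And>u. u \<in> {-1..1} \<Longrightarrow> \<bar>h u - g u\<bar> < \<epsilon> / 4"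
    using Stone_Weierstrass_real_polynomial_function[of "{-1..1}" h "\<epsilon>/4"] \<open>\<epsilon> > 0\<close> by auto
  obtain c n where c: "g = (\<lambda>x. \<Sum>i\<le>n. c i * x ^ i)"
    using g(1) real_polynomial_function_iff_sum by blast
  have "\<exists>M. has_mean a P (\<lambda>x. cos x ^ i) M" for i
    using has_mean_cos_power[of i 0] by simp
  then obtain M where M: "\<And>i. has_mean a P (\<lambda>x. cos x ^ i) (M i)" by metis
  \<comment> \<open>Adding the approximation error turns \<open>g\<close> into a true majorant:
    nonnegative everywhere and at least 1 on the arc.\<close>
  define f where "f x = g (cos x) + \<epsilon> / 4" for x
  obtain N where N: "has_mean a P f N"
  proof -
    have "has_mean a P (\<lambda>x. (\<Sum>i\<le>n. c i * cos x ^ i) + \<epsilon> / 4 * cos (of_int 0 * x))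
        ((\<Sum>i\<le>n. c i * M i) + \<epsilon> / 4 * (if (0::int) = 0 then 1 else 0))"
      by (intro has_mean_add has_mean_sum has_mean_cmult has_mean_cos M) auto
    then show ?thesis using that by (simp add: f_def[abs_def] c)
  qed
  have gc: "\<bar>h (cos x) - g (cos x)\<bar> < \<epsilon> / 4" for x by (intro g(2)) auto
  have h01: "0 \<le> h u" for u by (simp add: h_def)
  have f0: "f x \<ge> 0" for x using gc[of x] h01[of "cos x"] unfolding f_def by linarith
  have f1: "f x \<ge> 1" if "cos x \<ge> cos w" for x
  proof -
    have "h (cos x) = 1" using that AB unfolding h_def A_def[symmetric] by (simp add: max_def min_def)
    then show ?thesis using gc[of x] unfolding f_def by linarith
  qed
  have f2: "f x \<le> (if x \<in> {- (w + \<delta>)..w + \<delta>} then 1 else 0) + \<epsilon> / 2" if "x \<in> {-pi..pi}" for x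
  proof -
    have "h (cos x) \<le> (if x \<in> {- (w + \<delta>)..w + \<delta>} then 1 else 0)"
    proof (cases "x \<in> {- (w + \<delta>)..w + \<delta>}")
      case False
      then have "\<bar>x\<bar> \<ge> w + \<delta>" "\<bar>x\<bar> \<le> pi" using that by auto
      then have "cos \<bar>x\<bar> \<le> B" unfolding B_def using w d by (intro cos_monotone_0_pi_le) auto
      then have "(cos x - B) / (A - B) \<le> 0" using AB by (simp add: divide_nonpos_pos)
      then show ?thesis using False by (simp add: h_def)
    qed (simp add: h_def)
    then show ?thesis using gc[of x] unfolding f_def by linarith
  qed
  have "((\<lambda>x. 1::real) has_integral 2 * (w + \<delta>)) {- (w + \<delta>)..w + \<delta>}"
    using has_integral_const_real[of "1::real" "- (w + \<delta>)" "w + \<delta>"] w d by simp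
  then have "((\<lambda>x. if x \<in> {- (w + \<delta>)..w + \<delta>} then 1 else (0::real)) has_integral 2 * (w + \<delta>)) {-pi..pi}"
    using d by (subst has_integral_restrict) auto
  moreover have "((\<lambda>x. \<epsilon> / 2) has_integral pi * \<epsilon>) {-pi..pi}"
    using has_integral_const_real[of "\<epsilon> / 2" "-pi" pi] by simp
  ultimately have "((\<lambda>x. (if x \<in> {- (w + \<delta>)..w + \<delta>} then 1 else 0) + \<epsilon> / 2)
      has_integral (2 * (w + \<delta>) + pi * \<epsilon>)) {-pi..pi}"
    by (rule has_integral_add)
  then have "2 * pi * N \<le> 2 * (w + \<delta>) + pi * \<epsilon>"
    using N f2 unfolding has_mean_def by (blast intro: has_integral_le)
  then have "N \<le> (2 * (w + \<delta>) + pi * \<epsilon>) / (2 * pi)"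
    by (simp add: field_simps)
  also have "\<dots> = w / pi + \<delta> / pi + \<epsilon> / 2" by (simp add: field_simps)
  also have "\<dots> < w / pi + \<epsilon>" using d \<open>\<epsilon> > 0\<close> by linarith
  finally have "N < w / pi + \<epsilon>" .
  then have "\<forall>\<^sub>F r in sequentially. (\<Sum>t\<in>P r. f (a t)) / real (card (P r)) < w / pi + \<epsilon>"
    using N unfolding has_mean_def by (intro order_tendstoD(2)[where y = N]) auto
  then show ?thesis
  proof (rule eventually_mono)
    fix r assume *: "(\<Sum>t\<in>P r. f (a t)) / real (card (P r)) < w / pi + \<epsilon>"
    have "real (card {t \<in> P r. cos (a t) \<ge> cos w}) = (\<Sum>t\<in>{t \<in> P r. cos (a t) \<ge> cos w}. 1)" by simp
    also have "\<dots> \<le> (\<Sum>t\<in>{t \<in> P r. cos (a t) \<ge> cos w}. f (a t))" by (intro sum_mono f1) auto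
    also have "\<dots> \<le> (\<Sum>t\<in>P r. f (a t))" using fin f0 by (intro sum_mono2) auto
    finally show "real (card {t \<in> P r. cos (a t) \<ge> cos w}) / real (card (P r)) < w / pi + \<epsilon>"
      using * by (meson divide_right_mono le_less_trans of_nat_0_le_iff)
  qed
qed

end

section \<open>Frequencies of equal arcs and of intervals\<close>

definition arc_index :: "nat \<Rightarrow> real \<Rightarrow> nat" where
  "arc_index m x = nat \<lfloor>real m * x / (2 * pi)\<rfloor>"

lemma arc_index_bounds:
  assumes "x \<ge> 0"
  shows "real (arc_index m x) \<le> real m * x / (2 * pi)" "real m * x / (2 * pi) < real (arc_index m x) + 1"
proof -
  have "\<lfloor>real m * x / (2 * pi)\<rfloor> \<ge> 0" using assms by simp
  then show "real (arc_index m x) \<le> real m * x / (2 * pi)" "real m * x / (2 * pi) < real (arc_index m x) + 1"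
    unfolding arc_index_def by linarith+
qed

lemma arc_index_less:
  assumes "x \<in> {0..<2 * pi}" "m > 0"
  shows "arc_index m x < m"
proof -
  have "real m * x / (2 * pi) < real m" using assms by (simp add: field_simps)
  then have "real (arc_index m x) < real m" using arc_index_bounds(1)[of x m] assms by simp
  then show ?thesis by simp
qed

lemma arc_index_mono: "x \<le> y \<Longrightarrow> arc_index m x \<le> arc_index m y"
  unfolding arc_index_def by (intro nat_mono floor_mono divide_right_mono mult_left_mono) auto

text \<open>Each of the \<open>m\<close> half-open arcs of length \<open>2 * pi / m\<close> has
  asymptotic frequency at most \<open>1 / m\<close>. Since the frequencies add up to 1, none of them
  can stay below \<open>1 / m\<close> either.\<close>

lemma (in equidistributing) arc_frequency:
  assumes range: "\<And>r t. t \<in> P r \<Longrightarrow> a t \<in> {0..<2 * pi}" and c: "c < m"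
  shows "(\<lambda>r. real (card {t \<in> P r. arc_index m (a t) = c}) / real (card (P r))) \<longlonglongrightarrow> 1 / real m"
proof -
  define F where "F c r = real (card {t \<in> P r. arc_index m (a t) = c}) / real (card (P r))" for c r
  have upper: "\<forall>\<^sub>F r in sequentially. F c r < 1 / real m + \<epsilon>" if "\<epsilon> > 0" "c < m" for \<epsilon> c
  proof (cases "m = 1")
    \<comment> \<open>A single arc has half-width \<open>pi\<close>, which the bound for arcs
      excludes; here the trivial bound 1 suffices.\<close>
    case True
    have "F c r \<le> 1" for r
      unfolding F_def using fin[of r] card_pos[of r] by (auto simp: divide_le_eq_1 intro!: card_mono)
    then have "F c r < 1 / real m + \<epsilon>" for r
      using True that(1) by (simp add: le_less_trans[of _ 1])
    then show ?thesis by simp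
  next
    case False
    \<comment> \<open>The midpoint of arc \<open>c\<close>, so that the arc lies within distance
      \<open>pi / m\<close> of \<theta>.\<close>
    define \<theta> where "\<theta> = 2 * pi * (real c + 1/2) / real m"
    have w: "0 < pi / real m" "pi / real m < pi" using False that by (auto simp: field_simps)
    interpret s: equidistributing "\<lambda>t. a t - \<theta>" P by (rule shift)
    have sub: "{t \<in> P r. arc_index m (a t) = c} \<subseteq> {t \<in> P r. cos (a t - \<theta>) \<ge> cos (pi / real m)}" for r
    proof safe
      fix t assume t: "t \<in> P r" "c = arc_index m (a t)"
      define v where "v = real m * a t / (2 * pi)"
      have "real c \<le> v" "v < real c + 1"
        using arc_index_bounds[of "a t" m] range[OF t(1)] t(2) by (auto simp: v_def)
      then have "\<bar>v - real c - 1/2\<bar> \<le> 1/2" by linarith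
      then have "\<bar>v - real c - 1/2\<bar> * (2 * pi / real m) \<le> 1/2 * (2 * pi / real m)"
        by (intro mult_right_mono) auto
      moreover have "a t - \<theta> = (v - real c - 1/2) * (2 * pi / real m)"
        using that(2) by (simp add: \<theta>_def v_def field_simps)
      ultimately have "\<bar>a t - \<theta>\<bar> \<le> pi / real m"
        by (simp add: abs_mult)
      then have "cos (pi / real m) \<le> cos \<bar>a t - \<theta>\<bar>" using w by (intro cos_monotone_0_pi_le) auto
      then show "cos (pi / real m) \<le> cos (a t - \<theta>)" by simp
    qed
    have "F c r \<le> real (card {t \<in> P r. cos (a t - \<theta>) \<ge> cos (pi / real m)}) / real (card (P r))" for r
      unfolding F_def using fin[of r] by (intro divide_right_mono of_nat_mono card_mono sub) auto
    moreover have "pi / real m / pi = 1 / real m" by simp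
    ultimately show ?thesis
      using s.arc_upper_bound[OF w that(1)] by (auto elim!: eventually_mono intro: le_less_trans)
  qed
  have total: "(\<Sum>c<m. F c r) = 1" for r
  proof -
    have "P r = (\<Union>c<m. {t \<in> P r. arc_index m (a t) = c})"
      using arc_index_less range c by auto
    then have "card (P r) = card (\<Union>c<m. {t \<in> P r. arc_index m (a t) = c})" by simp
    also have "\<dots> = (\<Sum>c<m. card {t \<in> P r. arc_index m (a t) = c})"
      using fin[of r] by (intro card_UN_disjoint) auto
    finally have "real (card (P r)) = (\<Sum>c<m. real (card {t \<in> P r. arc_index m (a t) = c}))" by simp
    then show ?thesis
      using card_pos[of r] by (simp add: F_def flip: sum_divide_distrib)
  qed
  have "F c \<longlonglongrightarrow> 1 / real m"
  proof (rule order_tendstoI)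
    fix x assume "1 / real m < x"
    then show "\<forall>\<^sub>F r in sequentially. F c r < x" using upper[of "x - 1 / real m" c] c by simp
  next
    fix x assume x: "x < 1 / real m"
    \<comment> \<open>With this choice \<open>1 - (m - 1) * (1 / m + \<epsilon>)\<close> equals
      \<open>x + \<epsilon>\<close>, which exceeds \<open>x\<close>.\<close>
    define \<epsilon> where "\<epsilon> = (1 / real m - x) / real m"
    have e: "\<epsilon> > 0" using x c by (simp add: \<epsilon>_def)
    have "\<forall>\<^sub>F r in sequentially. \<forall>d\<in>{..<m}. F d r < 1 / real m + \<epsilon>"
      using upper[OF e] by (intro eventually_ball_finite) auto
    then show "\<forall>\<^sub>F r in sequentially. x < F c r"
    proof (rule eventually_mono)
      fix r assume r: "\<forall>d\<in>{..<m}. F d r < 1 / real m + \<epsilon>"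
      have "1 = F c r + (\<Sum>d\<in>{..<m} - {c}. F d r)"
        using total[of r] c by (simp add: sum.remove)
      also have "\<dots> \<le> F c r + (\<Sum>d\<in>{..<m} - {c}. 1 / real m + \<epsilon>)"
        using r by (intro add_left_mono sum_mono) (auto intro: less_imp_le)
      also have "\<dots> = F c r + (real m - 1) * (1 / real m + \<epsilon>)" using c by (simp add: of_nat_diff)
      also have "\<dots> = F c r + 1 - 1 / real m + (1 / real m - x) - \<epsilon>"
        using c by (simp add: \<epsilon>_def field_simps)
      finally show "x < F c r" using e by linarith
    qed
  qed
  then show ?thesis by (simp add: F_def[abs_def])
qed

text \<open>The interval contains all arcs strictly between those of its endpoints and is covered by
  these together with the two end arcs. Both unions have limiting frequency within
  \<open>3 / m\<close> of the length of the interval divided by \<open>2 * pi\<close>, and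
  \<open>m\<close> is arbitrary.\<close>

lemma interval_frequency:
  assumes u: "\<And>n. u n \<in> {0..<2 * pi}"
    and freq: "\<And>m c. c < m \<Longrightarrow> (\<lambda>n. real (card {j. j < n \<and> arc_index m (u j) = c}) / real n) \<longlonglongrightarrow> 1 / real m"
    and xy: "0 \<le> x" "x < y" "y < 2 * pi"
  shows "(\<lambda>n. (1 / real n) * (\<Sum>j<n. indicat_real {x..y} (u j))) \<longlonglongrightarrow> (y - x) / (2 * pi)"
proof -
  define G where "G n = (1 / real n) * (\<Sum>j<n. indicat_real {x..y} (u j))" for n
  define F where "F m c n = real (card {j. j < n \<and> arc_index m (u j) = c}) / real n" for m c n
  have G: "G n = real (card {j. j < n \<and> u j \<in> {x..y}}) / real n" for n
  proof -
    have "(\<Sum>j<n. indicat_real {x..y} (u j)) = real (card ({..<n} \<inter> {j. u j \<in> {x..y}}))"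
      unfolding indicator_def of_bool_def by (simp add: sum.If_cases)
    also have "{..<n} \<inter> {j. u j \<in> {x..y}} = {j. j < n \<and> u j \<in> {x..y}}" by auto
    finally show ?thesis by (simp add: G_def)
  qed
  have Fsum: "(\<Sum>c\<in>C. F m c n) = real (card {j. j < n \<and> arc_index m (u j) \<in> C}) / real n"
    if "finite C" for C m n
  proof -
    have "{j. j < n \<and> arc_index m (u j) \<in> C} = (\<Union>c\<in>C. {j. j < n \<and> arc_index m (u j) = c})" by auto
    also have "card \<dots> = (\<Sum>c\<in>C. card {j. j < n \<and> arc_index m (u j) = c})"
      using that by (intro card_UN_disjoint) auto
    finally show ?thesis by (simp add: F_def sum_divide_distrib)
  qed
  have Flim: "(\<lambda>n. \<Sum>c\<in>C. F m c n) \<longlonglongrightarrow> real (card C) / real m" if "C \<subseteq> {..<m}" for C m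
  proof -
    have "(\<lambda>n. \<Sum>c\<in>C. F m c n) \<longlonglongrightarrow> (\<Sum>c\<in>C. 1 / real m)"
      unfolding F_def using that by (intro tendsto_sum freq) auto
    then show ?thesis by simp
  qed
  have near: "\<forall>\<^sub>F n in sequentially. \<bar>G n - (y - x) / (2 * pi)\<bar> < 3 / real m" if m: "m > 0" for m
  proof -
    define p where "p = arc_index m x"
    define q where "q = arc_index m y"
    have pq: "p \<le> q" "q < m" unfolding p_def q_def using xy m
      by (auto intro: arc_index_mono arc_index_less)
    have pb: "real p \<le> real m * x / (2 * pi)" "real m * x / (2 * pi) < real p + 1"
      unfolding p_def using xy by (auto intro: arc_index_bounds)
    have qb: "real q \<le> real m * y / (2 * pi)" "real m * y / (2 * pi) < real q + 1"
      unfolding q_def using xy by (auto intro: arc_index_bounds)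
    define L where "L = (y - x) / (2 * pi)"
    have mL: "real m * L = real m * y / (2 * pi) - real m * x / (2 * pi)"
      by (simp add: L_def field_simps)
    have "real (card {p..q}) / real m < L + 3 / real m"
    proof -
      have "real (card {p..q}) < real m * L + 3" using pq pb qb mL by (simp add: of_nat_diff)
      then show ?thesis using m by (simp add: field_simps)
    qed
    then have up: "\<forall>\<^sub>F n in sequentially. (\<Sum>c\<in>{p..q}. F m c n) < L + 3 / real m"
      by (rule order_tendstoD(2)[OF Flim, rotated]) (use pq in auto)
    have "L - 3 / real m < real (card {p<..<q}) / real m"
    proof -
      have "L - 3 / real m = (real m * L - 3) / real m" using m by (simp add: field_simps)
      also have "\<dots> < real (card {p<..<q}) / real m"
      proof (rule divide_strict_right_mono)
        \<comment> \<open>For \<open>p = q\<close> there is no inner arc and the count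
          \<open>q - p - 1\<close> would be negative, hence the separate case.\<close>
        show "real m * L - 3 < real (card {p<..<q})"
          using pq pb qb mL by (cases "p = q") (simp_all add: of_nat_diff)
      qed (use m in simp)
      finally show ?thesis .
    qed
    then have lo: "\<forall>\<^sub>F n in sequentially. L - 3 / real m < (\<Sum>c\<in>{p<..<q}. F m c n)"
      by (rule order_tendstoD(1)[OF Flim, rotated]) (use pq in auto)
    have "G n \<le> (\<Sum>c\<in>{p..q}. F m c n)" for n
      unfolding G Fsum[OF finite_atLeastAtMost]
      by (intro divide_right_mono of_nat_mono card_mono) (auto simp: p_def q_def arc_index_mono)
    note G_upper = this
    have G_lower: "(\<Sum>c\<in>{p<..<q}. F m c n) \<le> G n" for n
      unfolding G Fsum[OF finite_greaterThanLessThan]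
    proof (intro divide_right_mono of_nat_mono card_mono)
      show "{j. j < n \<and> arc_index m (u j) \<in> {p<..<q}} \<subseteq> {j. j < n \<and> u j \<in> {x..y}}"
        using arc_index_mono unfolding p_def q_def
        by (auto simp: not_le[symmetric]) (meson leD le_cases)+
    qed auto
    show ?thesis
      using up lo
    proof eventually_elim
      case (elim n)
      then show ?case using G_upper[of n] G_lower[of n] unfolding L_def by linarith
    qed
  qed
  have "G \<longlonglongrightarrow> (y - x) / (2 * pi)"
  proof (rule tendstoI)
    fix e :: real assume "e > 0"
    then obtain m where m: "m > 0" "3 / real m < e"
    proof -
      obtain m where m: "3 / e < real m" using reals_Archimedean2 by blast
      have "0 < 3 / e" using \<open>e > 0\<close> by simp
      with m have "real m > 0" by linarith
      with m have "3 / real m < e" using \<open>e > 0\<close> by (simp add: field_simps)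
      with \<open>real m > 0\<close> have "m > 0" "3 / real m < e" by simp_all
      then show ?thesis using that by blast
    qed
    show "\<forall>\<^sub>F n in sequentially. dist (G n) ((y - x) / (2 * pi)) < e"
      using near[OF m(1)] m(2) by (auto simp: dist_real_def elim!: eventually_mono)
  qed
  then show ?thesis by (simp add: G_def[abs_def])
qed

section \<open>Motions and supertiles\<close>

lemma cis_rmod [simp]: "cis (x rmod (2 * pi)) = cis x"
  by (simp add: cis_eq_iff rcong_def)

text \<open>Integrality of \<open>k\<close> makes the character insensitive to reducing the angle
  modulo a full turn.\<close>

lemma cis_of_int_mult_rmod: "cis (of_int k * (x rmod (2 * pi))) = cis (of_int k * x)"
proof -
  have "cis (of_int k * y) = cis y powi k" for y
    by (simp add: Complex.DeMoivre2[symmetric] cis_power_int)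
  then show ?thesis by simp
qed

lemma cis_rot_angle_comp_motion:
  "cis (rot_angle (comp_motion g h)) =
     cis (rot_angle g) * (if mirrored g then cnj (cis (rot_angle h)) else cis (rot_angle h))"
  by (simp add: comp_motion_def cis_mult cis_cnj)

lemma comp_motion_sel [simp]:
  "mirrored (comp_motion g h) \<longleftrightarrow> mirrored g \<noteq> mirrored h"
  "translation (comp_motion g h) = act g (translation h)"
  by (simp_all add: comp_motion_def)

text \<open>The phase determines a normalized angle. Identities between motions can thus be checked
  through \<open>cis\<close>, without arithmetic modulo \<open>2 * pi\<close>.\<close>

lemma motion_eqI:
  assumes "normalized g" "normalized h" "mirrored g = mirrored h"
    "cis (rot_angle g) = cis (rot_angle h)" "translation g = translation h"
  shows "g = h"
proof -
  have "[rot_angle g = rot_angle h] (rmod (2 * pi))" using assms(4) cis_eq_iff by blast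
  then have "rot_angle g = rot_angle h"
    using assms(1,2) by (auto simp: rcong_def normalized_def)
  then show ?thesis using assms by (simp add: motion.expand)
qed

lemma comp_motion_assoc: "comp_motion (comp_motion f g) h = comp_motion f (comp_motion g h)"
  by (rule motion_eqI)
    (auto simp: normalized_comp_motion cis_rot_angle_comp_motion act_comp_motion mult.assoc)

lemma comp_motion_id: "normalized g \<Longrightarrow> comp_motion g id_motion = g"
  by (rule motion_eqI)
     (auto simp: normalized_comp_motion, auto simp: comp_motion_def id_motion_def act_def)

lemma comp_motion_left_cancel:
  assumes "normalized h" "normalized h'" "comp_motion g h = comp_motion g h'"
  shows "h = h'"
proof (rule motion_eqI[OF assms(1,2)])
  show "mirrored h = mirrored h'" using assms(3) by (auto simp: comp_motion_def)
  have "cis (rot_angle g) * (if mirrored g then cnj (cis (rot_angle h)) else cis (rot_angle h))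
      = cis (rot_angle g) * (if mirrored g then cnj (cis (rot_angle h')) else cis (rot_angle h'))"
    using assms(3) by (metis cis_rot_angle_comp_motion)
  then show "cis (rot_angle h) = cis (rot_angle h')" by (simp split: if_splits del: cis_cnj)
  have "act g (translation h) = act g (translation h')" using assms(3) by (simp add: comp_motion_def)
  then show "translation h = translation h'" by (simp add: act_def split: if_splits)
qed

lemma scale_comp_motion:
  "scale_motion c (comp_motion g h) = comp_motion (scale_motion c g) (scale_motion c h)"
  by (simp add: scale_motion_def comp_motion_def act_def algebra_simps)

lemma scale_scale_motion: "scale_motion c (scale_motion d g) = scale_motion (c * d) g"
  by (simp add: scale_motion_def)

lemma scale_motion_sel [simp]:
  "mirrored (scale_motion c g) = mirrored g" "rot_angle (scale_motion c g) = rot_angle g"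
  by (simp_all add: scale_motion_def)

lemma act_scale_motion: "act (scale_motion c g) (of_real c * z) = of_real c * act g z"
  by (simp add: act_def scale_motion_def algebra_simps)

lemma inj_act: "inj (act g)"
  by (rule injI) (auto simp: act_def split: if_splits)

text \<open>A motion is an injective real-linear map followed by a translation, and both commute
  with taking interiors.\<close>

lemma interior_act_image: "interior (act g ` A) = act g ` interior A"
proof -
  define f where "f z = cis (rot_angle g) * (if mirrored g then cnj z else z)" for z
  have lin: "linear f"
    by (intro linearI) (auto simp: f_def distrib_left scaleR_conv_of_real)
  have "inj f" by (rule injI) (auto simp: f_def split: if_splits)
  have act: "act g ` S = (+) (translation g) ` f ` S" for S
    by (simp add: act_def f_def image_image add.commute)
  then show ?thesis
    using interior_translation[of "translation g" "f ` A"] interior_injective_linear_image[OF lin \<open>inj f\<close>, of A]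
    unfolding act by simp
qed

lemma interior_scale_image:
  assumes "c \<noteq> 0"
  shows "interior ((\<lambda>z. complex_of_real c * z) ` A) = (\<lambda>z. of_real c * z) ` interior A"
  using assms by (intro interior_injective_linear_image linearI injI)
    (auto simp: distrib_left scaleR_conv_of_real)

text \<open>Since \<open>comp_motion\<close> reduces angles, \<open>move g\<close> may merge
  different encodings of one tile; on normalized tiles it is injective.\<close>

definition normalized_tiles :: "'i tile set \<Rightarrow> bool" where
  "normalized_tiles P \<longleftrightarrow> (\<forall>t\<in>P. normalized (snd t))"

lemma inj_on_move: "normalized_tiles P \<Longrightarrow> inj_on (move g) P"
  by (auto simp: inj_on_def normalized_tiles_def move_def prod_eq_iff dest: comp_motion_left_cancel)

lemma move_comp: "move (comp_motion g h) t = move g (move h t)"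
  by (simp add: move_def comp_motion_assoc)

section \<open>Characters of tile angles under congruence\<close>

definition tile_char :: "int \<Rightarrow> 'i tile \<Rightarrow> complex" where
  "tile_char k t = cis (of_int k * tile_angle t)"

lemma norm_tile_char [simp]: "norm (tile_char k t) = 1"
  by (simp add: tile_char_def)

text \<open>A reflection reverses angles and therefore conjugates the character; the rotation
  contributes a common phase.\<close>

lemma tile_char_move:
  "tile_char k (move g t) =
     cis (of_int k * rot_angle g) * (if mirrored g then cnj (tile_char k t) else tile_char k t)"
  by (simp add: tile_char_def tile_angle_def move_def comp_motion_def cis_of_int_mult_rmod
      cis_mult cis_cnj ring_distribs)

lemma sum_tile_char_move:
  assumes "normalized_tiles P"
  shows "(\<Sum>t\<in>move g ` P. tile_char k t) =
     cis (of_int k * rot_angle g) *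
       (if mirrored g then cnj (\<Sum>t\<in>P. tile_char k t) else (\<Sum>t\<in>P. tile_char k t))"
  by (simp add: sum.reindex inj_on_move[OF assms] tile_char_move sum_distrib_left)

lemma congruent_tiles_card:
  assumes "congruent_tiles P Q" "normalized_tiles P"
  shows "card Q = card P"
  using assms by (auto simp: congruent_tiles_def card_image inj_on_move)

text \<open>A common phase and a possible conjugation leave the modulus unchanged. Estimates for
  supertiles thus carry over to congruent patches of a tiling.\<close>

lemma congruent_tiles_sum_tile_char:
  assumes "congruent_tiles P Q" "normalized_tiles P"
  shows "norm (\<Sum>t\<in>Q. tile_char k t) = norm (\<Sum>t\<in>P. tile_char k t)"
  using assms by (auto simp: congruent_tiles_def sum_tile_char_move norm_mult simp del: cnj_sum)

section \<open>Iterated substitution and the geometry of supertiles\<close>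

locale substitution_system =
  fixes mir :: bool and T :: "'i::finite \<Rightarrow> complex set" and lam :: real and \<sigma> :: "'i \<Rightarrow> 'i tile set"
  assumes sss: "self_similar_substitution mir T lam \<sigma>"
begin

abbreviation iterate :: "nat \<Rightarrow> 'i tile set \<Rightarrow> 'i tile set" where
  "iterate m P \<equiv> (substitute lam \<sigma> ^^ m) P"

lemma lam_gt: "lam > 1"
  and interior_T: "interior (T i) \<noteq> {}"
  and finite_\<sigma>: "finite (\<sigma> i)"
  and packing_\<sigma>: "packing T (\<sigma> i)"
  and scale_T: "(\<lambda>z. of_real lam * z) ` T i = (\<Union>t\<in>\<sigma> i. support T t)"
  using sss by (auto simp: self_similar_substitution_def)

lemma subst_tile_move:
  "subst_tile lam \<sigma> (move g t) = move (scale_motion lam g) ` subst_tile lam \<sigma> t"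
  by (simp add: subst_tile_def image_image scale_comp_motion flip: move_comp)
     (simp add: move_def scale_comp_motion)

lemma substitute_move: "substitute lam \<sigma> (move g ` P) = move (scale_motion lam g) ` substitute lam \<sigma> P"
  by (simp add: substitute_def image_UN subst_tile_move)

text \<open>Every substitution step multiplies translations by \<open>lam\<close> and keeps the
  rotational part, so copies of a patch develop into copies.\<close>

lemma iterate_move: "iterate m (move g ` P) = move (scale_motion (lam ^ m) g) ` iterate m P"
proof (induction m)
  case 0
  then show ?case by (simp add: scale_motion_def)
next
  case (Suc m)
  then show ?case by (simp add: substitute_move scale_scale_motion)
qed

lemma iterate_UN: "iterate m P = (\<Union>t\<in>P. iterate m {t})"
proof (induction m)
  case (Suc m)
  have "iterate (Suc m) P = substitute lam \<sigma> (\<Union>t\<in>P. iterate m {t})" using Suc by simp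
  also have "\<dots> = (\<Union>t\<in>P. iterate (Suc m) {t})" by (auto simp: substitute_def)
  finally show ?case .
qed auto

lemma iterate_singleton:
  assumes "normalized (snd t)"
  shows "iterate m {t} = move (scale_motion (lam ^ m) (snd t)) ` supertile lam \<sigma> m (fst t)"
proof -
  have "{t} = move (snd t) ` {(fst t, id_motion)}"
    using assms by (simp add: move_def comp_motion_id)
  then show ?thesis by (metis iterate_move supertile_def)
qed

lemma normalized_tiles_substitute: "normalized_tiles (substitute lam \<sigma> P)"
  by (auto simp: normalized_tiles_def substitute_def subst_tile_def move_def normalized_comp_motion)

lemma normalized_tiles_supertile: "normalized_tiles (supertile lam \<sigma> m i)"
  by (cases m) (simp_all add: supertile_def normalized_tiles_substitute,
      simp add: normalized_tiles_def normalized_def id_motion_def)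

lemma finite_iterate: "finite P \<Longrightarrow> finite (iterate m P)"
  by (induction m) (auto simp: substitute_def subst_tile_def finite_\<sigma>)

lemma finite_supertile: "finite (supertile lam \<sigma> m i)"
  by (simp add: supertile_def finite_iterate)

lemma support_subst_tile:
  assumes "u \<in> subst_tile lam \<sigma> t"
  shows "support T u \<subseteq> (\<lambda>z. of_real lam * z) ` support T t"
proof -
  obtain v where v: "v \<in> \<sigma> (fst t)" "u = move (scale_motion lam (snd t)) v"
    using assms by (auto simp: subst_tile_def)
  have "support T u \<subseteq> act (scale_motion lam (snd t)) ` (\<lambda>z. of_real lam * z) ` T (fst t)"
    unfolding v(2) support_move scale_T using v(1) by (intro image_mono) auto
  also have "\<dots> = (\<lambda>z. of_real lam * z) ` support T t"
    by (simp add: image_image support_def act_scale_motion)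
  finally show ?thesis .
qed

lemma support_iterate:
  assumes "u \<in> iterate m {t}"
  shows "support T u \<subseteq> (\<lambda>z. of_real (lam ^ m) * z) ` support T t"
  using assms
proof (induction m arbitrary: u)
  case (Suc m)
  then have "u \<in> substitute lam \<sigma> (iterate m {t})" by simp
  then obtain v where v: "v \<in> iterate m {t}" "u \<in> subst_tile lam \<sigma> v"
    unfolding substitute_def[of lam \<sigma> "iterate m {t}"] by blast
  have "support T u \<subseteq> (\<lambda>z. of_real lam * z) ` (\<lambda>z. of_real (lam ^ m) * z) ` support T t"
    using support_subst_tile[OF v(2)] Suc.IH[OF v(1)] by blast
  then show ?case by (simp add: image_image mult.assoc)
qed simp

lemma interior_support: "interior (support T t) \<noteq> {}"
  by (simp add: support_def interior_act_image interior_T)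

text \<open>Descendants of a tile stay inside the inflated tile, and inflation preserves the
  disjointness of interiors.\<close>

lemma interior_disjoint_iterate:
  assumes "packing T P" "t \<in> P" "t' \<in> P" "t \<noteq> t'" "u \<in> iterate m {t}" "u' \<in> iterate m {t'}"
  shows "interior (support T u) \<inter> interior (support T u') = {}"
proof -
  have ne: "lam ^ m \<noteq> 0" using lam_gt by simp
  have "interior (support T u) \<subseteq> (\<lambda>z. of_real (lam ^ m) * z) ` interior (support T t)"
    using interior_mono[OF support_iterate[OF assms(5)]] interior_scale_image[OF ne] by metis
  moreover have "interior (support T u') \<subseteq> (\<lambda>z. of_real (lam ^ m) * z) ` interior (support T t')"
    using interior_mono[OF support_iterate[OF assms(6)]] interior_scale_image[OF ne] by metis
  moreover have "interior (support T t) \<inter> interior (support T t') = {}"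
    using assms(1-4) by (auto simp: packing_def)
  ultimately show ?thesis using ne by fastforce
qed

text \<open>A common descendant would have interior disjoint from itself, whereas supports of tiles
  have nonempty interior. This turns decompositions of supertiles into genuine sums.\<close>

lemma iterate_disjoint:
  assumes "packing T P" "t \<in> P" "t' \<in> P" "t \<noteq> t'"
  shows "iterate m {t} \<inter> iterate m {t'} = {}"
  using interior_disjoint_iterate[OF assms] interior_support by fastforce

lemma packing_move:
  assumes "packing T P"
  shows "packing T (move g ` P)"
proof -
  have "interior (support T (move g s)) \<inter> interior (support T (move g t)) = {}"
    if "s \<in> P" "t \<in> P" "move g s \<noteq> move g t" for s t
  proof -
    have "interior (support T s) \<inter> interior (support T t) = {}"
      using that assms unfolding packing_def by metis
    then show ?thesis
      by (simp add: support_move interior_act_image image_Int[OF inj_act, symmetric])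
  qed
  then show ?thesis by (auto simp: packing_def)
qed

text \<open>Two new tiles either have the same parent, where the packing property of \<sigma>
  applies, or lie in different inflated parents.\<close>

lemma packing_substitute:
  assumes "packing T P"
  shows "packing T (substitute lam \<sigma> P)"
  unfolding packing_def
proof (intro ballI impI)
  fix u u' assume u: "u \<in> substitute lam \<sigma> P" "u' \<in> substitute lam \<sigma> P" "u \<noteq> u'"
  then obtain t t' where t: "t \<in> P" "t' \<in> P" "u \<in> subst_tile lam \<sigma> t" "u' \<in> subst_tile lam \<sigma> t'"
    by (auto simp: substitute_def)
  show "interior (support T u) \<inter> interior (support T u') = {}"
  proof (cases "t = t'")
    case True
    have "packing T (subst_tile lam \<sigma> t)" by (simp add: subst_tile_def packing_move packing_\<sigma>)
    then show ?thesis using t u(3) True by (simp add: packing_def)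
  next
    case False
    then show ?thesis
      using interior_disjoint_iterate[OF assms t(1,2) False, of u 1 u'] t(3,4) by (simp add: substitute_def)
  qed
qed

lemma packing_supertile: "packing T (supertile lam \<sigma> m i)"
  unfolding supertile_def by (induction m) (simp_all add: packing_substitute, simp add: packing_def)

lemma supertile_add:
  "supertile lam \<sigma> (m + n) i = (\<Union>t\<in>supertile lam \<sigma> n i. iterate m {t})"
  using iterate_UN[of m "supertile lam \<sigma> n i"] by (simp add: supertile_def funpow_add)

text \<open>The tiles of level \<open>n\<close> form a packing, so their level \<open>m\<close>
  descendants are disjoint families.\<close>

lemma sum_supertile_add:
  "(\<Sum>u\<in>supertile lam \<sigma> (m + n) i. f u) = (\<Sum>t\<in>supertile lam \<sigma> n i. \<Sum>u\<in>iterate m {t}. f u)"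
  unfolding supertile_add
  by (intro sum.UNION_disjoint ballI impI iterate_disjoint[OF packing_supertile] finite_iterate)
     (auto simp: finite_supertile)

section \<open>Recursions for tile counts and character sums\<close>

definition tile_count :: "nat \<Rightarrow> 'i \<Rightarrow> nat" where
  "tile_count m i = card (supertile lam \<sigma> m i)"

definition char_sum :: "int \<Rightarrow> nat \<Rightarrow> 'i \<Rightarrow> complex" where
  "char_sum k m i = (\<Sum>t\<in>supertile lam \<sigma> m i. tile_char k t)"

lemma tile_count_add: "tile_count (m + n) i = (\<Sum>t\<in>supertile lam \<sigma> n i. tile_count m (fst t))"
proof -
  have "tile_count (m + n) i = (\<Sum>t\<in>supertile lam \<sigma> n i. \<Sum>u\<in>iterate m {t}. 1)"
    unfolding tile_count_def card_eq_sum by (rule sum_supertile_add)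
  also have "\<dots> = (\<Sum>t\<in>supertile lam \<sigma> n i. tile_count m (fst t))"
  proof (rule sum.cong[OF refl])
    fix t assume "t \<in> supertile lam \<sigma> n i"
    then have "normalized (snd t)" using normalized_tiles_supertile by (auto simp: normalized_tiles_def)
    then show "(\<Sum>u\<in>iterate m {t}. 1) = tile_count m (fst t)"
      by (simp add: iterate_singleton tile_count_def card_image inj_on_move[OF normalized_tiles_supertile])
  qed
  finally show ?thesis .
qed

text \<open>Inside the large supertile, the descendants of \<open>t\<close> form a copy of the level
  \<open>m\<close> supertile of its type, moved by the motion of \<open>t\<close>. Hence the phase
  of \<open>t\<close> appears as a factor, with conjugation for mirrored tiles.\<close>

lemma char_sum_add:
  "char_sum k (m + n) i = (\<Sum>t\<in>supertile lam \<sigma> n i.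
     tile_char k t * (if mirrored (snd t) then cnj (char_sum k m (fst t)) else char_sum k m (fst t)))"
  unfolding char_sum_def[of k "m + n"] sum_supertile_add
proof (rule sum.cong[OF refl])
  fix t assume "t \<in> supertile lam \<sigma> n i"
  then have "normalized (snd t)" using normalized_tiles_supertile by (auto simp: normalized_tiles_def)
  then show "(\<Sum>u\<in>iterate m {t}. tile_char k u) =
      tile_char k t * (if mirrored (snd t) then cnj (char_sum k m (fst t)) else char_sum k m (fst t))"
    unfolding iterate_singleton[OF \<open>normalized (snd t)\<close>]
      sum_tile_char_move[OF normalized_tiles_supertile] char_sum_def
    by (simp add: tile_char_def tile_angle_def)
qed

lemma norm_char_sum_le: "norm (char_sum k m i) \<le> tile_count m i"
  unfolding char_sum_def tile_count_def by (rule order_trans[OF norm_sum]) simp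

end

context substitution_system begin

lemma supertile_one: "supertile lam \<sigma> 1 i = \<sigma> i"
  using supertile_1[OF sss] .

text \<open>A positive entry of the matrix power yields a chain of types. Its first link is a tile
  of \<open>\<sigma> i\<close>; the rest is found inside the supertile of that tile.\<close>

lemma supertile_types_positive:
  assumes "((\<lambda>A. substitution_matrix \<sigma> ** A) ^^ m) (mat 1) $ i $ j > 0"
  shows "\<exists>t\<in>supertile lam \<sigma> m i. fst t = j"
  using assms
proof (induction m arbitrary: i)
  case 0
  then show ?case by (auto simp: mat_def supertile_def split: if_splits)
next
  case (Suc m)
  define A where "A = ((\<lambda>A. substitution_matrix \<sigma> ** A) ^^ m) (mat 1)"
  have "(\<Sum>l\<in>UNIV. substitution_matrix \<sigma> $ i $ l * A $ l $ j) > 0"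
    using Suc.prems by (simp add: A_def matrix_matrix_mult_def)
  then obtain l where l: "substitution_matrix \<sigma> $ i $ l > 0" "A $ l $ j > 0"
    by (metis (no_types, lifting) bot_nat_0.not_eq_extremum mult_is_0 sum.neutral)
  have "{t \<in> \<sigma> i. tile_type t = l} \<noteq> {}"
    using l(1) by (auto simp: substitution_matrix_def card_gt_0_iff)
  then obtain s where s: "s \<in> supertile lam \<sigma> 1 i" "fst s = l"
    by (auto simp: supertile_one tile_type_def simp del: One_nat_def)
  obtain t where t: "t \<in> supertile lam \<sigma> m l" "fst t = j"
    using Suc.IH[of l] l(2) by (auto simp: A_def)
  have "normalized (snd s)" using s(1) normalized_tiles_supertile by (auto simp: normalized_tiles_def)
  then have "move (scale_motion (lam ^ m) (snd s)) t \<in> supertile lam \<sigma> (m + 1) i"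
    unfolding supertile_add using s t by (auto simp: iterate_singleton simp del: One_nat_def intro!: bexI[of _ s])
  then show ?case using t(2) by (intro bexI[of _ "move (scale_motion (lam ^ m) (snd s)) t"]) (auto simp: move_def)
qed

end

section \<open>Cancellation in character sums\<close>

locale primitive_substitution = substitution_system mir T lam \<sigma>
  for mir :: bool and T :: "'i::finite \<Rightarrow> complex set" and lam :: real and \<sigma> :: "'i \<Rightarrow> 'i tile set" +
  assumes prim: "primitive \<sigma>"
begin

lemma all_types:
  obtains q where "\<And>i j. \<exists>t\<in>supertile lam \<sigma> q i. fst t = j"
  using prim supertile_types_positive unfolding primitive_def by blast

text \<open>By primitivity some level \<open>q\<close> supertile of type \<open>j\<close> contains a
  tile of type \<open>i\<close>, so the count for \<open>i\<close> at level \<open>m\<close> is at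
  most that for \<open>j\<close> at level \<open>m + q\<close>. This in turn is at most
  \<open>K\<close> times the count at level \<open>m\<close>, where \<open>K\<close> bounds all
  counts of level \<open>q\<close>.\<close>

lemma tile_count_comparable:
  obtains K where "K > 0" "\<And>m i j. real (tile_count m i) \<le> K * real (tile_count m j)"
proof -
  obtain q where q: "\<And>i j. \<exists>t\<in>supertile lam \<sigma> q i. fst t = j" by (rule all_types) blast
  define K where "K = (\<Sum>i\<in>UNIV. tile_count q i)"
  have K: "tile_count q i \<le> K" for i unfolding K_def by (rule member_le_sum) auto
  have "tile_count m i \<le> K * tile_count m j" for m i j
  proof -
    obtain t where t: "t \<in> supertile lam \<sigma> q j" "fst t = i" using q by blast
    have "tile_count m i \<le> (\<Sum>t\<in>supertile lam \<sigma> q j. tile_count m (fst t))"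
      using member_le_sum[OF t(1), of "\<lambda>t. tile_count m (fst t)"] t(2) finite_supertile by simp
    also have "\<dots> = tile_count (q + m) j" by (simp add: tile_count_add[symmetric] add.commute)
    also have "\<dots> \<le> (\<Sum>t\<in>supertile lam \<sigma> m j. K)"
      unfolding tile_count_add by (intro sum_mono K)
    also have "\<dots> = K * tile_count m j" by (simp add: tile_count_def)
    finally show ?thesis .
  qed
  \<comment> \<open>Passing to \<open>K + 1\<close> makes positivity of the constant
    immediate.\<close>
  then have "real (tile_count m i) \<le> real (K + 1) * real (tile_count m j)" for m i j
    by (metis (no_types, opaque_lifting) of_nat_le_iff of_nat_mult add_leE distrib_right le_add1 order_trans)
  then show ?thesis using that[of "real (K + 1)"] by auto
qed

text \<open>
  Two tiles of the same type and orientation carry summands of equal modulus in the recursion for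
  character sums, but with different phases, so that a fixed proportion of the sum cancels.
\<close>

lemma char_sum_contraction:
  assumes t: "t1 \<in> supertile lam \<sigma> n i" "t2 \<in> supertile lam \<sigma> n i" "fst t1 = fst t2"
      "mirrored (snd t1) = mirrored (snd t2)" "tile_char k t1 \<noteq> tile_char k t2"
  obtains \<kappa> where "\<kappa> < 1"
    "\<And>m R. (\<And>j. norm (char_sum k m j) \<le> R * real (tile_count m j)) \<Longrightarrow>
        norm (char_sum k (m + n) i) \<le> \<kappa> * R * real (tile_count (m + n) i)"
proof -
  obtain K where K: "K > 0" "\<And>m i j. real (tile_count m i) \<le> K * real (tile_count m j)"
    by (rule tile_count_comparable) blast
  \<comment> \<open>The loss in the triangle inequality for two unit numbers; it vanishes only if
    they coincide.\<close>
  define d where "d = 2 - norm (tile_char k t1 + tile_char k t2)"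
  have d: "d > 0"
  proof -
    have "norm (tile_char k t1 + tile_char k t2) \<noteq> 2"
    proof
      assume "norm (tile_char k t1 + tile_char k t2) = 2"
      then have "norm (tile_char k t1 + tile_char k t2) = norm (tile_char k t1) + norm (tile_char k t2)" by simp
      then have "norm (tile_char k t1) *\<^sub>R tile_char k t2 = norm (tile_char k t2) *\<^sub>R tile_char k t1"
        using norm_triangle_eq by blast
      then show False using t(5) by simp
    qed
    then show ?thesis using norm_triangle_ineq[of "tile_char k t1" "tile_char k t2"] by (simp add: d_def)
  qed
  \<comment> \<open>\<open>D\<close> relates the whole to the pair: the count at level
    \<open>m + n\<close> is at most \<open>D\<close> times the count of one level \<open>m\<close>
    supertile of the type of \<open>t1\<close>. As \<open>D\<close> does not depend on
    \<open>m\<close>, neither does the proportion that cancels.\<close>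
  define D where "D = real (tile_count n i) * K"
  have neq: "t1 \<noteq> t2" using t(5) by auto
  have "tile_count n i > 0" using t(1) finite_supertile by (auto simp: tile_count_def card_gt_0_iff)
  then have D: "D > 0" using K(1) by (simp add: D_def)
  have "norm (char_sum k (m + n) i) \<le> (1 - d / D) * R * real (tile_count (m + n) i)"
    if R: "\<And>j. norm (char_sum k m j) \<le> R * real (tile_count m j)" for m R
  proof -
    define z where "z t = (if mirrored (snd t) then cnj (char_sum k m (fst t)) else char_sum k m (fst t))"
      for t :: "'i tile"
    define S where "S = supertile lam \<sigma> n i"
    define N where "N = real (tile_count m (fst t1))"
    have nz: "norm (z t) \<le> R * real (tile_count m (fst t))" for t using R by (simp add: z_def)
    have z12: "z t2 = z t1" using t by (simp add: z_def)
    have "char_sum k (m + n) i = (\<Sum>t\<in>S. tile_char k t * z t)"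
      unfolding char_sum_add z_def S_def ..
    also have "\<dots> = tile_char k t1 * z t1 + tile_char k t2 * z t2 + (\<Sum>t\<in>S - {t1, t2}. tile_char k t * z t)"
      using t neq finite_supertile by (subst sum.subset_diff[of "{t1, t2}"]) (auto simp: S_def)
    also have "\<dots> = (tile_char k t1 + tile_char k t2) * z t1 + (\<Sum>t\<in>S - {t1, t2}. tile_char k t * z t)"
      by (simp add: z12 distrib_right)
    finally have "norm (char_sum k (m + n) i)
        \<le> norm (tile_char k t1 + tile_char k t2) * norm (z t1) + (\<Sum>t\<in>S - {t1, t2}. norm (z t))"
      by (auto simp flip: norm_mult intro!: order_trans[OF norm_triangle_ineq] add_mono
            order_trans[OF norm_sum] sum_mono) (simp add: norm_mult)
    also have "\<dots> \<le> (2 - d) * (R * N) + (\<Sum>t\<in>S - {t1, t2}. R * real (tile_count m (fst t)))"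
      unfolding N_def d_def by (intro add_mono sum_mono mult_mono nz) auto
    also have "\<dots> = (\<Sum>t\<in>S. R * real (tile_count m (fst t))) - d * R * N"
    proof -
      have "(\<Sum>t\<in>S. R * real (tile_count m (fst t)))
        = (\<Sum>t\<in>S - {t1, t2}. R * real (tile_count m (fst t))) + (\<Sum>t\<in>{t1, t2}. R * real (tile_count m (fst t)))"
        using t finite_supertile by (intro sum.subset_diff) (auto simp: S_def)
      then show ?thesis using neq t(3) by (simp add: N_def algebra_simps)
    qed
    also have "(\<Sum>t\<in>S. R * real (tile_count m (fst t))) = R * real (tile_count (m + n) i)"
      by (simp add: tile_count_add S_def sum_distrib_left)
    also have "R * real (tile_count (m + n) i) - d * R * N
        \<le> R * real (tile_count (m + n) i) - d * R * (real (tile_count (m + n) i) / D)"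
    proof -
      have "real (tile_count (m + n) i) \<le> (\<Sum>t\<in>S. K * N)"
        unfolding tile_count_add S_def of_nat_sum N_def by (intro sum_mono K)
      also have "\<dots> = D * N" by (simp add: D_def S_def tile_count_def)
      finally have *: "real (tile_count (m + n) i) / D \<le> N" using D by (simp add: field_simps)
      have "R * N \<ge> R * (real (tile_count (m + n) i) / D)"
      \<comment> \<open>The sign of \<open>R\<close> is not assumed: it follows from the bound on a
        norm when \<open>N > 0\<close>, while for \<open>N = 0\<close> both sides are equal.\<close>
      proof (cases "N = 0")
        case True
        moreover have "real (tile_count (m + n) i) / D \<ge> 0" using D by simp
        ultimately have "real (tile_count (m + n) i) / D = N" using * True by linarith
        then show ?thesis by (simp only: order_refl)
      next
        case False
        then have "N > 0" by (simp add: N_def)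
        moreover have "0 \<le> R * N" using R[of "fst t1"] norm_ge_zero order_trans unfolding N_def by blast
        ultimately have "R \<ge> 0" by (simp add: zero_le_mult_iff)
        then show ?thesis using * by (rule mult_left_mono[rotated])
      qed
      from mult_left_mono[OF this less_imp_le[OF d]] show ?thesis
        by (simp only: mult.assoc diff_left_mono)
    qed
    also have "\<dots> = (1 - d / D) * R * real (tile_count (m + n) i)" by (simp add: algebra_simps)
    finally show ?thesis .
  qed
  then show ?thesis using that[of "1 - d / D"] d D by simp
qed

text \<open>Equal type and orientation guarantee that both tiles multiply the same number in the
  recursion, as that number is conjugated for mirrored tiles.\<close>

definition phase_pair :: "int \<Rightarrow> 'i tile set \<Rightarrow> bool" where
  "phase_pair k P \<longleftrightarrow> (\<exists>t1\<in>P. \<exists>t2\<in>P. fst t1 = fst t2 \<and>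
     mirrored (snd t1) = mirrored (snd t2) \<and> tile_char k t1 \<noteq> tile_char k t2)"

lemma phase_pair_mono: "phase_pair k P \<Longrightarrow> P \<subseteq> Q \<Longrightarrow> phase_pair k Q"
  unfolding phase_pair_def by blast

text \<open>A motion acts on both characters by the same phase and the same possible conjugation,
  which is injective.\<close>

lemma phase_pair_move:
  assumes "phase_pair k P"
  shows "phase_pair k (move g ` P)"
proof -
  obtain t1 t2 where t: "t1 \<in> P" "t2 \<in> P" "fst t1 = fst t2" "mirrored (snd t1) = mirrored (snd t2)"
    "tile_char k t1 \<noteq> tile_char k t2"
    using assms unfolding phase_pair_def by blast
  have "fst (move g t1) = fst (move g t2)" "mirrored (snd (move g t1)) = mirrored (snd (move g t2))"
    using t by (auto simp: move_def)
  moreover have "tile_char k (move g t1) \<noteq> tile_char k (move g t2)"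
    using t(5) by (simp add: tile_char_move)
  ultimately show ?thesis unfolding phase_pair_def using t(1,2) by blast
qed

text \<open>By primitivity a copy of the given supertile sits in a supertile of every type,
  \<open>q\<close> levels higher.\<close>

lemma phase_pair_all_supertiles:
  assumes "phase_pair k (supertile lam \<sigma> n i)"
  obtains n' where "\<And>j. phase_pair k (supertile lam \<sigma> n' j)"
proof -
  obtain q where q: "\<And>i j. \<exists>t\<in>supertile lam \<sigma> q i. fst t = j" by (rule all_types) blast
  have "phase_pair k (supertile lam \<sigma> (n + q) j)" for j
  proof -
    obtain t where t: "t \<in> supertile lam \<sigma> q j" "fst t = i" using q by blast
    then have "normalized (snd t)" using normalized_tiles_supertile by (auto simp: normalized_tiles_def)
    then have "iterate n {t} = move (scale_motion (lam ^ n) (snd t)) ` supertile lam \<sigma> n i"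
      using t(2) by (simp add: iterate_singleton)
    moreover have "iterate n {t} \<subseteq> supertile lam \<sigma> (n + q) j" using t(1) unfolding supertile_add by blast
    ultimately show ?thesis using phase_pair_move[OF assms] phase_pair_mono by metis
  qed
  then show ?thesis using that by blast
qed

text \<open>Passing up \<open>p\<close> levels improves the bound relative to the tile count by a
  fixed factor below 1. The iteration starts from the trivial bound with constant 1.\<close>

lemma char_sum_decay:
  assumes "phase_pair k (supertile lam \<sigma> n i)" and "\<epsilon> > 0"
  obtains M where "\<And>m j. m \<ge> M \<Longrightarrow> norm (char_sum k m j) \<le> \<epsilon> * real (tile_count m j)"
proof -
  obtain p where p: "\<And>j. phase_pair k (supertile lam \<sigma> p j)"
    using phase_pair_all_supertiles[OF assms(1)] by blast
  have "\<exists>\<kappa><1. \<forall>m R. (\<forall>l. norm (char_sum k m l) \<le> R * real (tile_count m l)) \<longrightarrow>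
        norm (char_sum k (m + p) j) \<le> \<kappa> * R * real (tile_count (m + p) j)" for j
    using p[of j] char_sum_contraction[of _ p j _ k] unfolding phase_pair_def by metis
  then obtain \<kappa> where \<kappa>: "\<And>j. \<kappa> j < 1"
    "\<And>j m R. (\<And>l. norm (char_sum k m l) \<le> R * real (tile_count m l)) \<Longrightarrow>
        norm (char_sum k (m + p) j) \<le> \<kappa> j * R * real (tile_count (m + p) j)"
    by metis
  \<comment> \<open>There are finitely many types, so one factor serves all; the \<open>1/2\<close>
    keeps it positive.\<close>
  define \<rho> where "\<rho> = max (1/2) (Max (range \<kappa>))"
  have \<rho>: "0 < \<rho>" "\<rho> < 1" "\<And>j. \<kappa> j \<le> \<rho>"
    using \<kappa>(1) by (auto simp: \<rho>_def le_max_iff_disj)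
  have decay: "norm (char_sum k (m + q * p) j) \<le> \<rho> ^ q * real (tile_count (m + q * p) j)" for m q j
  proof (induction q arbitrary: j)
    case 0
    then show ?case by (simp add: norm_char_sum_le)
  next
    case (Suc q)
    have "norm (char_sum k (m + q * p + p) j) \<le> \<kappa> j * \<rho> ^ q * real (tile_count (m + q * p + p) j)"
      using Suc.IH by (rule \<kappa>(2))
    also have "\<dots> \<le> \<rho> * \<rho> ^ q * real (tile_count (m + q * p + p) j)"
      using \<rho> by (intro mult_right_mono) auto
    finally show ?case by (simp add: ac_simps)
  qed
  obtain q where q: "\<rho> ^ q < \<epsilon>" using real_arch_pow_inv[OF \<open>\<epsilon> > 0\<close> \<rho>(2)] by blast
  have "norm (char_sum k m j) \<le> \<epsilon> * real (tile_count m j)" if "m \<ge> q * p" for m j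
  proof -
    \<comment> \<open>The starting level \<open>m - q * p\<close> is arbitrary, so every large level
      is reached and not only multiples of \<open>p\<close>.\<close>
    have "norm (char_sum k m j) \<le> \<rho> ^ q * real (tile_count m j)"
      using decay[of "m - q * p" q j] that by simp
    also have "\<dots> \<le> \<epsilon> * real (tile_count m j)" using q by (intro mult_right_mono) auto
    finally show ?thesis .
  qed
  then show ?thesis using that by blast
qed

text \<open>Without such a pair, the character would take only one value for each type and
  orientation, hence finitely many. Each value belongs to finitely many angles because
  \<open>k \<noteq> 0\<close>, contradicting the infinity of angles.\<close>

lemma pinwheel_phase_pair:
  assumes X: "substitution_tiling mir T lam \<sigma> X" "pinwheel_like X" and k: "k \<noteq> 0"
  obtains n i where "phase_pair k (supertile lam \<sigma> n i)"
proof -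
  have ang: "tile_angle ` X \<subseteq> {0..<2 * pi}"
    using X(1) by (auto simp: substitution_tiling_def tiling_def copies_def normalized_def tile_angle_def)
  have "phase_pair k X"
  proof (rule ccontr)
    assume neg: "\<not> ?thesis"
    \<comment> \<open>A representative tile for each type and orientation.\<close>
    define F where "F v = (SOME t. t \<in> X \<and> (fst t, mirrored (snd t)) = v)" for v
    have "tile_char k t = tile_char k (F (fst t, mirrored (snd t)))" if "t \<in> X" for t
    proof -
      have "F (fst t, mirrored (snd t)) \<in> X \<and>
          (fst (F (fst t, mirrored (snd t))), mirrored (snd (F (fst t, mirrored (snd t))))) = (fst t, mirrored (snd t))"
        unfolding F_def by (rule someI[of _ t]) (use that in simp)
      then show ?thesis using neg that unfolding phase_pair_def by (metis prod.inject)
    qed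
    then have "tile_char k ` X \<subseteq> (\<lambda>v. tile_char k (F v)) ` UNIV" by auto
    then have "finite (tile_char k ` X)" by (rule finite_subset) simp
    moreover have "finite {x \<in> {0..<2 * pi}. cis (of_int k * x) = w}" for w
    proof (cases "\<exists>x0. cis (of_int k * x0) = w")
      case True
      then obtain x0 where x0: "cis (of_int k * x0) = w" by blast
      \<comment> \<open>Two solutions differ by a multiple of \<open>2 * pi / k\<close>, and only
        finitely many of those multiples meet the bounded range.\<close>
      have "{x \<in> {0..<2 * pi}. cis (of_int k * x) = w}
          \<subseteq> (\<lambda>n. x0 + of_int n * (2 * pi) / of_int k) ` {n. \<bar>of_int n\<bar> \<le> \<bar>of_int k\<bar> * (2 * pi + \<bar>x0\<bar>)}"
      proof
        fix x assume x: "x \<in> {x \<in> {0..<2 * pi}. cis (of_int k * x) = w}"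
        then have "cis (of_int k * x0) = cis (of_int k * x)" using x0 by simp
        then have "[of_int k * x0 = of_int k * x] (rmod (2 * pi))" unfolding cis_eq_iff .
        then obtain n where n: "of_int k * x = of_int k * x0 + of_int n * (2 * pi)"
          unfolding rcong_altdef by blast
        have "x = x0 + of_int n * (2 * pi) / of_int k" using n k by (simp add: field_simps)
        moreover have "\<bar>real_of_int n\<bar> \<le> \<bar>of_int k\<bar> * (2 * pi + \<bar>x0\<bar>)"
        proof -
          have "\<bar>real_of_int n\<bar> * 1 \<le> \<bar>real_of_int n\<bar> * (2 * pi)"
            using pi_ge_two by (intro mult_left_mono) auto
          also have "\<dots> = \<bar>of_int n * (2 * pi)\<bar>" by (simp add: abs_mult)
          also have "of_int n * (2 * pi) = of_int k * (x - x0)" using n by (simp add: algebra_simps)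
          also have "\<bar>of_int k * (x - x0)\<bar> = \<bar>of_int k\<bar> * \<bar>x - x0\<bar>" by (simp add: abs_mult)
          also have "\<dots> \<le> \<bar>of_int k\<bar> * (2 * pi + \<bar>x0\<bar>)" using x by (intro mult_left_mono) auto
          finally show ?thesis by simp
        qed
        ultimately show "x \<in> (\<lambda>n. x0 + of_int n * (2 * pi) / of_int k) ` {n. \<bar>of_int n\<bar> \<le> \<bar>of_int k\<bar> * (2 * pi + \<bar>x0\<bar>)}"
          by blast
      qed
      moreover have "finite {n::int. \<bar>of_int n\<bar> \<le> C}" for C :: real
      proof (rule finite_subset)
        show "{n::int. \<bar>of_int n\<bar> \<le> C} \<subseteq> {- \<lceil>C\<rceil>..\<lceil>C\<rceil>}" by (auto simp: abs_le_iff) linarith+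
      qed simp
      ultimately show ?thesis by (meson finite_imageI finite_subset)
    next
      case False
      then have "{x \<in> {0..<2 * pi}. cis (of_int k * x) = w} = {}" by blast
      then show ?thesis by (simp only: finite.emptyI)
    qed
    moreover have "tile_angle ` X \<subseteq> (\<Union>w\<in>tile_char k ` X. {x \<in> {0..<2 * pi}. cis (of_int k * x) = w})"
    proof
      fix x assume "x \<in> tile_angle ` X"
      then obtain t where "t \<in> X" "x = tile_angle t" by blast
      then show "x \<in> (\<Union>w\<in>tile_char k ` X. {x \<in> {0..<2 * pi}. cis (of_int k * x) = w})"
        using ang by (intro UN_I[of "tile_char k t"]) (auto simp: tile_char_def)
    qed
    ultimately have "finite (tile_angle ` X)" by (meson finite_UN finite_subset)
    then show False using X(2) by (simp add: pinwheel_like_def)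
  qed
  then obtain t1 t2 where t: "t1 \<in> X" "t2 \<in> X" "phase_pair k {t1, t2}"
    unfolding phase_pair_def by blast
  \<comment> \<open>The two tiles form a patch of \<open>X\<close>, so a congruent patch occurs in a
    supertile.\<close>
  then obtain n i Q where "Q \<subseteq> supertile lam \<sigma> n i" "congruent_tiles {t1, t2} Q"
    using X(1) unfolding substitution_tiling_def by (metis empty_subsetI finite.emptyI finite_insert insert_subset)
  then show ?thesis
    using that phase_pair_move[OF t(3)] phase_pair_mono unfolding congruent_tiles_def by metis
qed

section \<open>From supertiles to arrangements of a tiling\<close>

text \<open>\<open>X\<close> supplies phase pairs in supertiles, and from there on the estimates
  concern \<sigma> alone. They reach \<open>Y\<close> through its initial segments congruent to
  supertiles; the given order is then balanced between sparsely chosen segments of this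
  kind.\<close>

lemma statistical_circular_symmetry_if_arrangement:
  assumes X: "substitution_tiling mir T lam \<sigma> X" "pinwheel_like X"
    and Y: "substitution_tiling mir T lam \<sigma> Y" and S: "supertile_arrangement lam \<sigma> Y S"
  shows "statistical_circular_symmetry lam \<sigma> Y"
proof -
  have bij: "bij_betw S UNIV Y" using S by (simp add: supertile_arrangement_def)
  then have inj: "inj S" and SY: "S j \<in> Y" for j by (auto simp: bij_betw_def)
  have norm_S: "normalized (snd (S j))" for j
    using SY Y by (auto simp: substitution_tiling_def tiling_def copies_def)
  then have normS: "normalized_tiles (S ` A)" for A by (auto simp: normalized_tiles_def)
  define u where "u j = tile_angle (S j)" for j
  have u: "u j \<in> {0..<2 * pi}" for j
    using norm_S by (simp add: u_def tile_angle_def normalized_def)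
  \<comment> \<open>The lengths of supertile segments; the condition \<open>l \<ge> 1\<close> makes
    the index sets \<open>P r\<close> nonempty.\<close>
  define L where "L = {l. l \<ge> 1 \<and> (\<exists>m\<ge>1. \<exists>i. congruent_tiles (S ` {..<l}) (supertile lam \<sigma> m i))}"
  have "\<exists>l\<ge>n. l \<in> L" for n
  proof -
    obtain l where "l \<ge> max n 1" "\<exists>m\<ge>1. \<exists>i. congruent_tiles (S ` {..<l}) (supertile lam \<sigma> m i)"
      using S unfolding supertile_arrangement_def by (meson max.cobounded2)
    then show ?thesis by (auto simp: L_def)
  qed
  then have L: "infinite L" by (simp add: infinite_nat_iff_unbounded_le)
  define P where "P r = {..<enumerate L r}" for r
  have decay: "\<exists>N. \<forall>l\<in>L. l \<ge> N \<longrightarrow> norm (\<Sum>j<l. cis (of_int k * u j)) \<le> \<epsilon> * real l"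
    if k: "k \<noteq> 0" and e: "\<epsilon> > 0" for k \<epsilon>
  proof -
    obtain n i where "phase_pair k (supertile lam \<sigma> n i)" by (rule pinwheel_phase_pair[OF X k])
    then obtain M where M: "\<And>m j. m \<ge> M \<Longrightarrow> norm (char_sum k m j) \<le> \<epsilon> * real (tile_count m j)"
      using char_sum_decay e by metis
    \<comment> \<open>Larger than every tile count of level below \<open>M\<close>, so a supertile
      segment of at least this length has level at least \<open>M\<close>.\<close>
    define N where "N = Suc (\<Sum>m<M. \<Sum>i\<in>UNIV. tile_count m i)"
    have "norm (\<Sum>j<l. cis (of_int k * u j)) \<le> \<epsilon> * real l" if l: "l \<in> L" "l \<ge> N" for l
    proof -
      obtain m i where c: "congruent_tiles (S ` {..<l}) (supertile lam \<sigma> m i)"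
        using l(1) by (auto simp: L_def)
      have card: "tile_count m i = l"
        using congruent_tiles_card[OF c normS] inj
        by (simp add: tile_count_def card_image inj_on_subset)
      have "m \<ge> M"
      proof (rule ccontr)
        assume "\<not> m \<ge> M"
        then have "tile_count m i \<le> (\<Sum>i\<in>UNIV. tile_count m i)" "m \<in> {..<M}"
          by (auto intro: member_le_sum)
        moreover from this(2) have "(\<Sum>i\<in>UNIV. tile_count m i) \<le> (\<Sum>m<M. \<Sum>i\<in>UNIV. tile_count m i)"
          by (intro member_le_sum[where f = "\<lambda>m. \<Sum>i\<in>UNIV. tile_count m i"]) auto
        ultimately show False using l(2) card by (simp add: N_def)
      qed
      have "(\<Sum>t\<in>S ` {..<l}. tile_char k t) = (\<Sum>j<l. cis (of_int k * u j))"
        using inj by (subst sum.reindex) (auto simp: tile_char_def u_def inj_on_def)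
      then have "norm (\<Sum>j<l. cis (of_int k * u j)) = norm (char_sum k m i)"
        using congruent_tiles_sum_tile_char[OF c normS, of k] by (simp add: char_sum_def)
      then show ?thesis using M[OF \<open>m \<ge> M\<close>, of i] card by simp
    qed
    then show ?thesis by blast
  qed
  interpret equidistributing u P
  proof
    show "finite (P r)" for r by (simp add: P_def)
    show "P r \<noteq> {}" for r using enumerate_in_set[OF L, of r] by (auto simp: P_def L_def lessThan_empty_iff)
    fix k :: int assume k: "k \<noteq> 0"
    show "(\<lambda>r. (\<Sum>t\<in>P r. cis (of_int k * u t)) / of_nat (card (P r))) \<longlonglongrightarrow> 0"
    proof (rule LIMSEQ_I)
      fix e :: real assume "e > 0"
      then obtain N where N: "\<And>l. l \<in> L \<Longrightarrow> l \<ge> N \<Longrightarrow> norm (\<Sum>j<l. cis (of_int k * u j)) \<le> e / 2 * real l"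
        using decay[OF k, of "e / 2"] by auto
      show "\<exists>no. \<forall>r\<ge>no. norm ((\<Sum>t\<in>P r. cis (of_int k * u t)) / of_nat (card (P r)) - 0) < e"
      proof (intro exI allI impI)
        fix r assume "r \<ge> N"
        then have "enumerate L r \<ge> N" using le_enumerate[OF L, of r] by simp
        then have *: "norm (\<Sum>j<enumerate L r. cis (of_int k * u j)) \<le> e / 2 * real (enumerate L r)"
          using N enumerate_in_set[OF L] by blast
        have "enumerate L r > 0" using enumerate_in_set[OF L, of r] by (auto simp: L_def)
        then have "norm (\<Sum>j<enumerate L r. cis (of_int k * u j)) / real (enumerate L r) \<le> e / 2"
          using * by (subst pos_divide_le_eq) auto
        then have "norm (\<Sum>j<enumerate L r. cis (of_int k * u j)) / real (enumerate L r) < e"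
          using \<open>e > 0\<close> by linarith
        then show "norm ((\<Sum>t\<in>P r. cis (of_int k * u t)) / of_nat (card (P r)) - 0) < e"
          by (simp add: P_def norm_divide)
      qed
    qed
  qed
  \<comment> \<open>All arcs of all partitions are listed in one sequence by decoding pairs
    \<open>(m, c)\<close>. Pairs without an arc, with \<open>c \<ge> m\<close>, get the empty set
    and frequency 0.\<close>
  define B where "B s = (case prod_decode s of (m, c) \<Rightarrow> {j. c < m \<and> arc_index m (u j) = c})" for s
  define q where "q s = (case prod_decode s of (m, c) \<Rightarrow> if c < m then 1 / real m else 0)" for s
  have freq: "\<exists>N. \<forall>l\<in>L. l \<ge> N \<longrightarrow> \<bar>real (card {j. j < l \<and> j \<in> B s}) - q s * real l\<bar> \<le> \<epsilon> * real l"
    if e: "\<epsilon> > 0" for s \<epsilon>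
  proof -
    obtain m c where mc: "prod_decode s = (m, c)" by fastforce
    show ?thesis
    proof (cases "c < m")
      case True
      have "(\<lambda>r. real (card {j \<in> P r. arc_index m (u j) = c}) / real (card (P r))) \<longlonglongrightarrow> 1 / real m"
        by (rule arc_frequency[OF u True])
      then obtain r0 where r0: "\<And>r. r \<ge> r0 \<Longrightarrow>
          norm (real (card {j \<in> P r. arc_index m (u j) = c}) / real (card (P r)) - 1 / real m) < \<epsilon>"
        using LIMSEQ_D[OF _ e] by meson
      have "\<bar>real (card {j. j < l \<and> j \<in> B s}) - q s * real l\<bar> \<le> \<epsilon> * real l"
        if l: "l \<in> L" "l \<ge> enumerate L r0" for l
      proof -
        obtain r where r: "l = enumerate L r" using enumerate_Ex[OF L] l(1) by metis
        then have "r \<ge> r0" using l(2) enumerate_mono[OF _ L, of r r0] by (meson leD not_le)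
        have l0: "real l > 0" using l(1) by (simp add: L_def)
        have "\<bar>real (card {j. j < l \<and> j \<in> B s}) / real l - q s\<bar> < \<epsilon>"
          using r0[OF \<open>r \<ge> r0\<close>] True by (simp add: B_def q_def mc P_def r)
        then have "\<bar>real (card {j. j < l \<and> j \<in> B s}) / real l - q s\<bar> * real l \<le> \<epsilon> * real l"
          using l0 by (intro mult_right_mono) auto
        also have "\<bar>real (card {j. j < l \<and> j \<in> B s}) / real l - q s\<bar> * real l
            = \<bar>(real (card {j. j < l \<and> j \<in> B s}) / real l - q s) * real l\<bar>"
          by (simp add: abs_mult)
        also have "(real (card {j. j < l \<and> j \<in> B s}) / real l - q s) * real l
            = real (card {j. j < l \<and> j \<in> B s}) - q s * real l"
          using l0 by (simp add: left_diff_distrib)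
        finally show ?thesis .
      qed
      then show ?thesis by blast
    next
      case False
      then show ?thesis using e by (simp add: B_def q_def mc)
    qed
  qed
  obtain \<pi> where \<pi>: "bij \<pi>" "\<And>n. \<exists>l\<in>L. l \<ge> n \<and> \<pi> ` {..<l} = {..<l}"
    "\<And>s. (\<lambda>n. real (card {j. j < n \<and> \<pi> j \<in> B s}) / real n) \<longlonglongrightarrow> q s"
    by (rule balanced_reordering[OF L, of B q]) (use freq in blast)+
  have "supertile_arrangement lam \<sigma> Y (S \<circ> \<pi>)"
    unfolding supertile_arrangement_def
  proof (intro conjI allI impI)
    show "bij_betw (S \<circ> \<pi>) UNIV Y" by (rule bij_betw_trans[OF \<pi>(1) bij])
    fix n :: nat
    obtain l where l: "l \<in> L" "l \<ge> n" "\<pi> ` {..<l} = {..<l}" using \<pi>(2) by blast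
    \<comment> \<open>The permutation preserves these initial segments as sets, so they remain
      congruent to the same supertiles.\<close>
    from l(3) have "(S \<circ> \<pi>) ` {..<l} = S ` {..<l}" by (simp only: image_comp[symmetric])
    then have "\<exists>m\<ge>1. \<exists>i. congruent_tiles ((S \<circ> \<pi>) ` {..<l}) (supertile lam \<sigma> m i)"
      using l(1) by (simp add: L_def)
    then show "\<exists>l\<ge>n. \<exists>m\<ge>1. \<exists>i. congruent_tiles ((S \<circ> \<pi>) ` {..<l}) (supertile lam \<sigma> m i)"
      using l(2) by blast
  qed
  moreover have "(\<lambda>n. (1 / real n) * (\<Sum>j<n. indicat_real {x..y} (tile_angle ((S \<circ> \<pi>) j))))
      \<longlonglongrightarrow> (y - x) / (2 * pi)" if "0 \<le> x" "x < y" "y < 2 * pi" for x y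
  proof -
    have "(\<lambda>n. real (card {j. j < n \<and> arc_index m (u (\<pi> j)) = c}) / real n) \<longlonglongrightarrow> 1 / real m"
      if "c < m" for m c
      using \<pi>(3)[of "prod_encode (m, c)"] that by (simp add: B_def q_def)
    then have "(\<lambda>n. (1 / real n) * (\<Sum>j<n. indicat_real {x..y} (u (\<pi> j)))) \<longlonglongrightarrow> (y - x) / (2 * pi)"
      using that by (intro interval_frequency u)
    then show ?thesis by (simp add: u_def)
  qed
  ultimately show ?thesis unfolding statistical_circular_symmetry_def by blast
qed

end

theorem theorem6p1:
  fixes T :: "'i::finite \<Rightarrow> complex set"
    and lam :: real
    and \<sigma> :: "'i \<Rightarrow> 'i tile set"
    and mir :: bool
    and X :: "'i tile set"
  assumes "self_similar_substitution mir T lam \<sigma>"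
    and "primitive \<sigma>"
    and "substitution_tiling mir T lam \<sigma> X"
    and "pinwheel_like X"
  shows "((\<exists>S. supertile_arrangement lam \<sigma> X S) \<longrightarrow> statistical_circular_symmetry lam \<sigma> X)
    \<and> (\<forall>Y\<in>tiling_space mir T lam \<sigma>.
         (\<exists>S. supertile_arrangement lam \<sigma> Y S) \<longrightarrow> statistical_circular_symmetry lam \<sigma> Y)"
proof -
  interpret primitive_substitution mir T lam \<sigma>
    using assms(1,2) by unfold_locales
  show ?thesis
    \<comment> \<open>The first claim is the case in which the second tiling is \<open>X\<close>
      itself.\<close>
    using statistical_circular_symmetry_if_arrangement[OF assms(3,4)] assms(3)
    by (auto simp: tiling_space_def)
qed

end
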